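(* Let $W$ be a finite-dimensional real vector space and let $\mathcal{P}$ be a class of polyhedra in $W$ which satisfies condition $(\dagger)$ and admits finite recession-restricted completions; let $\mathcal{C}=\{\operatorname{rec} P\mid P\in\mathcal{P}\}$. Then for any finite $\mathcal{C}$-fan $\Sigma$, any finite $\mathcal{P}$-complex $\Phi$ with $\operatorname{rec} P\in\Sigma$ for all $P\in\Phi$ has a $\mathcal{P}$-completion $\overline{\Phi}$ which is locally finite in $W(\Sigma)$ and satisfies $\{\operatorname{rec} P\mid P\in\overline{\Phi}\}=\Sigma$.
   Context: Polyhedral complexes need not be finite; a fan is a nonempty polyhedral complex of pointed cones. A $\mathcal{P}$-complex is a polyhedral complex with all members in $\mathcal{P}$; a $\mathcal{C}$-fan a fan with all cones in $\mathcal{C}$; a $\mathcal{P}$-completion of $\Phi$ is a $\mathcal{P}$-complex containing $\Phi$ as a subcomplex with union $W$. $\mathcal{P}$ satisfies $(\dagger)$ if: (I) $\mathcal{P}$ is closed under Minkowski sums; (II) every nonzero $\sigma\in\mathcal{C}$ has a ray $\rho\in\mathcal{C}$ meeting its relative interior; (III) every ray $\rho\in\mathcal{C}$ has a subdivision into polytopes in $\mathcal{P}$ that is locally finite in $\rho$. $\mathcal{P}$ admits finite recession-restricted completions if whenever $\Sigma$ is a finite $\mathcal{C}$-fan and $\Phi$ is a finite $\mathcal{P}$-complex with all recession cones in $\Sigma$, there is a finite $\mathcal{P}$-completion $\Pi$ of $\Phi$ such that $\{\operatorname{rec} P\mid P\in\Pi\}\cup\Sigma$ is a fan. $W(\Sigma)$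 is the tropical toric variety $\bigsqcup_{\sigma\in\Sigma}W/\operatorname{span}\sigma$ (each $W(\sigma)=\bigsqcup_{\tau\le\sigma}W/\operatorname{span}\tau$ identified with $\mathbb{R}_{\ge0}$-homogeneous monoid maps $\sigma^\vee\to\mathbb{R}\cup\{\infty\}$, topologized pointwise with $\mathbb{R}\cup\{\infty\}\cong\mathbb{R}_{\ge0}$ via $a\mapsto e^{-a}$, and glued). Locally finite in $X$: every point has a neighborhood meeting finitely many members. *)

theory Defs
  imports "HOL-Analysis.Analysis"
begin

text \<open>
  The finite-dimensional real vector space is a linear subspace \<open>W\<close> of an arbitrary Euclidean space,
  so that \<open>W = 0\<close> is covered (the types of class \<open>euclidean_space\<close> have positive dimension).
  Since \<open>W\<close> is itself a polyhedron, polyhedra in \<open>W\<close> are the polyhedra of the ambient space that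
  are contained in \<open>W\<close>, with the same faces and recession cones.  Members of a polyhedral complex
  are nonempty; the intersection of two members may be empty (\<open>{} face_of S\<close> always holds).
\<close>

definition rec_cone :: "'a::real_vector set \<Rightarrow> 'a set" where
  "rec_cone P = {v. \<forall>x\<in>P. \<forall>t\<ge>0. x + t *\<^sub>R v \<in> P}"

definition polyhedral_complex :: "'a::euclidean_space set set \<Rightarrow> bool" where
  "polyhedral_complex \<Phi> \<longleftrightarrow>
     (\<forall>P\<in>\<Phi>. polyhedron P \<and> P \<noteq> {}) \<and>
     (\<forall>P\<in>\<Phi>. \<forall>F. F face_of P \<and> F \<noteq> {} \<longrightarrow> F \<in> \<Phi>) \<and>
     (\<forall>P\<in>\<Phi>. \<forall>Q\<in>\<Phi>. (P \<inter> Q) face_of P \<and> (P \<inter> Q) face_of Q)"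

definition pointed_cone :: "'a::real_vector set \<Rightarrow> bool" where
  "pointed_cone \<sigma> \<longleftrightarrow> cone \<sigma> \<and> (\<forall>x. x \<in> \<sigma> \<and> - x \<in> \<sigma> \<longrightarrow> x = 0)"

definition fan :: "'a::euclidean_space set set \<Rightarrow> bool" where
  "fan \<Sigma> \<longleftrightarrow> \<Sigma> \<noteq> {} \<and> polyhedral_complex \<Sigma> \<and> (\<forall>\<sigma>\<in>\<Sigma>. pointed_cone \<sigma>)"

definition ray :: "'a::real_vector set \<Rightarrow> bool" where
  "ray \<rho> \<longleftrightarrow> (\<exists>v. v \<noteq> 0 \<and> \<rho> = {t *\<^sub>R v |t. t \<ge> 0})"

definition complex_in :: "'a::euclidean_space set set \<Rightarrow> 'a set set \<Rightarrow> bool" where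
  "complex_in \<P> \<Phi> \<longleftrightarrow> polyhedral_complex \<Phi> \<and> \<Phi> \<subseteq> \<P>"

definition fan_in :: "'a::euclidean_space set set \<Rightarrow> 'a set set \<Rightarrow> bool" where
  "fan_in \<C> \<Sigma> \<longleftrightarrow> fan \<Sigma> \<and> \<Sigma> \<subseteq> \<C>"

definition completion_in ::
  "'a::euclidean_space set \<Rightarrow> 'a set set \<Rightarrow> 'a set set \<Rightarrow> 'a set set \<Rightarrow> bool" where
  "completion_in W \<P> \<Phi> \<Psi> \<longleftrightarrow>
     polyhedral_complex \<Phi> \<and> complex_in \<P> \<Psi> \<and> \<Phi> \<subseteq> \<Psi> \<and> \<Union>\<Psi> = W"

definition dagger :: "'a::euclidean_space set set \<Rightarrow> bool" where
  "dagger \<P> \<longleftrightarrow>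
     (\<forall>P\<in>\<P>. \<forall>Q\<in>\<P>. {x + y |x y. x \<in> P \<and> y \<in> Q} \<in> \<P>) \<and>
     (\<forall>\<sigma>\<in>rec_cone ` \<P>. \<sigma> \<noteq> {0} \<longrightarrow>
        (\<exists>\<rho>\<in>rec_cone ` \<P>. ray \<rho> \<and> \<rho> \<inter> rel_interior \<sigma> \<noteq> {})) \<and>
     (\<forall>\<rho>\<in>rec_cone ` \<P>. ray \<rho> \<longrightarrow>
        (\<exists>S. complex_in \<P> S \<and> (\<forall>P\<in>S. polytope P) \<and> \<Union>S = \<rho> \<and>
             locally_finite_in (top_of_set \<rho>) S))"

definition finite_rec_restricted_completions ::
  "'a::euclidean_space set \<Rightarrow> 'a set set \<Rightarrow> bool" where
  "finite_rec_restricted_completions W \<P> \<longleftrightarrow>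
     (\<forall>\<Sigma> \<Phi>. finite \<Sigma> \<and> fan_in (rec_cone ` \<P>) \<Sigma> \<and> finite \<Phi> \<and> complex_in \<P> \<Phi> \<and>
             rec_cone ` \<Phi> \<subseteq> \<Sigma> \<longrightarrow>
        (\<exists>\<Psi>. finite \<Psi> \<and> completion_in W \<P> \<Phi> \<Psi> \<and> fan (rec_cone ` \<Psi> \<union> \<Sigma>)))"


subsection \<open>Tropical toric varieties\<close>

text \<open>
  \<open>\<real> \<union> {\<infinity>}\<close> is the set of extended reals other than \<open>-\<infinity>\<close>, with \<open>0 * \<infinity> = 0\<close> and the topology
  transported from the nonnegative reals along \<open>a \<mapsto> exp (-a)\<close>.
\<close>

definition ereal_exp_minus :: "ereal \<Rightarrow> real" where
  "ereal_exp_minus a = (if a = \<infinity> then 0 else exp (- real_of_ereal a))"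

definition trop_line :: "ereal topology" where
  "trop_line = pullback_topology {a. a \<noteq> -\<infinity>} ereal_exp_minus euclideanreal"

text \<open>The dual space of \<open>W\<close> is identified with \<open>W\<close> by means of the inner product.\<close>

definition dual_cone :: "'a::euclidean_space set \<Rightarrow> 'a set \<Rightarrow> 'a set" where
  "dual_cone W \<sigma> = {u \<in> W. \<forall>x\<in>\<sigma>. 0 \<le> u \<bullet> x}"

definition trop_hom :: "'a::euclidean_space set \<Rightarrow> 'a set \<Rightarrow> ('a \<Rightarrow> ereal) set" where
  "trop_hom W \<sigma> =
     {\<phi> \<in> dual_cone W \<sigma> \<rightarrow>\<^sub>E {a. a \<noteq> -\<infinity>}.
        \<phi> 0 = 0 \<and>
        (\<forall>u\<in>dual_cone W \<sigma>. \<forall>v\<in>dual_cone W \<sigma>. \<phi> (u + v) = \<phi> u + \<phi> v) \<and>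
        (\<forall>u\<in>dual_cone W \<sigma>. \<forall>t\<ge>0. \<phi> (t *\<^sub>R u) = ereal t * \<phi> u)}"

definition trop_hom_topology ::
  "'a::euclidean_space set \<Rightarrow> 'a set \<Rightarrow> ('a \<Rightarrow> ereal) topology" where
  "trop_hom_topology W \<sigma> =
     subtopology (product_topology (\<lambda>_. trop_line) (dual_cone W \<sigma>)) (trop_hom W \<sigma>)"

text \<open>
  A point of the stratum \<open>W / span \<tau>\<close> is a pair of \<open>\<tau>\<close> and a coset of \<open>span \<tau>\<close> in \<open>W\<close>.
\<close>

definition coset :: "'a::real_vector set \<Rightarrow> 'a \<Rightarrow> 'a set" where
  "coset V w = {w + v |v. v \<in> V}"

definition strata :: "'a::real_vector set \<Rightarrow> 'a set set \<Rightarrow> ('a set \<times> 'a set) set" where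
  "strata W T = {(\<tau>, coset (span \<tau>) w) |\<tau> w. \<tau> \<in> T \<and> w \<in> W}"

definition affine_strata :: "'a::real_vector set \<Rightarrow> 'a set \<Rightarrow> ('a set \<times> 'a set) set" where
  "affine_strata W \<sigma> = strata W {\<tau>. \<tau> face_of \<sigma> \<and> \<tau> \<noteq> {}}"

text \<open>
  The identification of \<open>affine_strata W \<sigma>\<close> with \<open>trop_hom W \<sigma>\<close>: the class of \<open>w\<close> in \<open>W / span \<tau>\<close>
  is the map sending \<open>u\<close> to \<open>u \<bullet> w\<close> if \<open>u\<close> vanishes on \<open>\<tau>\<close>, and to \<open>\<infinity>\<close> otherwise.
  In the first case the value does not depend on the representative \<open>w\<close>.
\<close>

definition strata_hom ::
  "'a::euclidean_space set \<Rightarrow> 'a set \<Rightarrow> 'a set \<times> 'a set \<Rightarrow> 'a \<Rightarrow> ereal" where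
  "strata_hom W \<sigma> = (\<lambda>(\<tau>, A). \<lambda>u\<in>dual_cone W \<sigma>.
     if \<forall>x\<in>\<tau>. u \<bullet> x = 0 then ereal (u \<bullet> (SOME w. w \<in> A)) else \<infinity>)"

definition affine_trop_toric ::
  "'a::euclidean_space set \<Rightarrow> 'a set \<Rightarrow> ('a set \<times> 'a set) topology" where
  "affine_trop_toric W \<sigma> =
     pullback_topology (affine_strata W \<sigma>) (strata_hom W \<sigma>) (trop_hom_topology W \<sigma>)"

text \<open>The glued topology is the final topology for the inclusions of the pieces.\<close>

definition trop_toric ::
  "'a::euclidean_space set \<Rightarrow> 'a set set \<Rightarrow> ('a set \<times> 'a set) topology" where
  "trop_toric W \<Sigma> = topology (\<lambda>U. U \<subseteq> strata W \<Sigma> \<and>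
     (\<forall>\<sigma>\<in>\<Sigma>. openin (affine_trop_toric W \<sigma>) (U \<inter> affine_strata W \<sigma>)))"

text \<open>The inclusion of \<open>W\<close> as the stratum \<open>W / span {0}\<close>.\<close>

definition trop_incl :: "'a::real_vector \<Rightarrow> 'a set \<times> 'a set" where
  "trop_incl w = ({0}, {w})"


lemma openin_trop_toric:
  "openin (trop_toric W \<Sigma>) U \<longleftrightarrow> U \<subseteq> strata W \<Sigma> \<and>
     (\<forall>\<sigma>\<in>\<Sigma>. openin (affine_trop_toric W \<sigma>) (U \<inter> affine_strata W \<sigma>))"
proof -
  have "istopology (\<lambda>U. U \<subseteq> strata W \<Sigma> \<and>
     (\<forall>\<sigma>\<in>\<Sigma>. openin (affine_trop_toric W \<sigma>) (U \<inter> affine_strata W \<sigma>)))"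
    unfolding istopology_def
  proof (rule conjI; clarify)
    fix S T :: "('a set \<times> 'a set) set"
    assume S: "S \<subseteq> strata W \<Sigma>"
      and oS: "\<forall>\<sigma>\<in>\<Sigma>. openin (affine_trop_toric W \<sigma>) (S \<inter> affine_strata W \<sigma>)"
      and oT: "\<forall>\<sigma>\<in>\<Sigma>. openin (affine_trop_toric W \<sigma>) (T \<inter> affine_strata W \<sigma>)"
    have "openin (affine_trop_toric W \<sigma>) (S \<inter> T \<inter> affine_strata W \<sigma>)" if "\<sigma> \<in> \<Sigma>" for \<sigma>
    proof -
      have "S \<inter> T \<inter> affine_strata W \<sigma> =
          (S \<inter> affine_strata W \<sigma>) \<inter> (T \<inter> affine_strata W \<sigma>)" by auto
      then show ?thesis using oS oT that by (simp add: openin_Int)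
    qed
    then show "S \<inter> T \<subseteq> strata W \<Sigma> \<and>
        (\<forall>\<sigma>\<in>\<Sigma>. openin (affine_trop_toric W \<sigma>) (S \<inter> T \<inter> affine_strata W \<sigma>))"
      using S by auto
  next
    fix K :: "('a set \<times> 'a set) set set"
    assume K: "\<forall>U\<in>K. U \<subseteq> strata W \<Sigma> \<and>
      (\<forall>\<sigma>\<in>\<Sigma>. openin (affine_trop_toric W \<sigma>) (U \<inter> affine_strata W \<sigma>))"
    have "openin (affine_trop_toric W \<sigma>) (\<Union>K \<inter> affine_strata W \<sigma>)" if "\<sigma> \<in> \<Sigma>" for \<sigma>
    proof -
      have "\<Union>K \<inter> affine_strata W \<sigma> = (\<Union>U\<in>K. U \<inter> affine_strata W \<sigma>)" by auto
      moreover have "openin (affine_trop_toric W \<sigma>) (\<Union>U\<in>K. U \<inter> affine_strata W \<sigma>)"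
        using K that by (intro openin_Union) blast
      ultimately show ?thesis by simp
    qed
    then show "\<Union>K \<subseteq> strata W \<Sigma> \<and>
        (\<forall>\<sigma>\<in>\<Sigma>. openin (affine_trop_toric W \<sigma>) (\<Union>K \<inter> affine_strata W \<sigma>))"
      using K by auto
  qed
  then show ?thesis
    unfolding trop_toric_def by (simp add: topology_inverse')
qed

lemma strata_hom_coset:
  assumes "u \<in> dual_cone W \<sigma>"
  shows "strata_hom W \<sigma> (\<tau>, coset (span \<tau>) w) u =
           (if \<forall>x\<in>\<tau>. u \<bullet> x = 0 then ereal (u \<bullet> w) else \<infinity>)"
proof (cases "\<forall>x\<in>\<tau>. u \<bullet> x = 0")
  case True
  have "w \<in> coset (span \<tau>) w"
    unfolding coset_def using span_zero[of \<tau>] by force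
  then have "(SOME a. a \<in> coset (span \<tau>) w) \<in> coset (span \<tau>) w"
    by (rule someI)
  then obtain v where v: "v \<in> span \<tau>" "(SOME a. a \<in> coset (span \<tau>) w) = w + v"
    unfolding coset_def by auto
  have "orthogonal u v"
    by (rule orthogonal_to_span[OF v(1)]) (use True in \<open>simp add: orthogonal_def\<close>)
  then show ?thesis
    using True v(2) assms by (simp add: strata_hom_def inner_add_right orthogonal_def)
next
  case False
  then show ?thesis using assms by (auto simp: strata_hom_def)
qed

lemma strata_hom_in_trop_hom:
  assumes W: "subspace W" and p: "p \<in> affine_strata W \<sigma>"
  shows "strata_hom W \<sigma> p \<in> trop_hom W \<sigma>"
proof -
  obtain \<tau> w where \<tau>: "\<tau> face_of \<sigma>" and p_eq: "p = (\<tau>, coset (span \<tau>) w)"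
    using p unfolding affine_strata_def strata_def by auto
  have sub: "\<tau> \<subseteq> \<sigma>" using \<tau> by (rule face_of_imp_subset)
  have z: "0 \<in> dual_cone W \<sigma>"
    using W by (simp add: dual_cone_def subspace_0)
  have add: "u + v \<in> dual_cone W \<sigma>" if "u \<in> dual_cone W \<sigma>" "v \<in> dual_cone W \<sigma>" for u v
    using that W by (simp add: dual_cone_def subspace_add inner_add_left)
  have sc: "t *\<^sub>R u \<in> dual_cone W \<sigma>" if "u \<in> dual_cone W \<sigma>" "t \<ge> 0" for u t
    using that W by (simp add: dual_cone_def subspace_scale)
  have perp: "(\<forall>x\<in>\<tau>. (u + v) \<bullet> x = 0) \<longleftrightarrow> (\<forall>x\<in>\<tau>. u \<bullet> x = 0) \<and> (\<forall>x\<in>\<tau>. v \<bullet> x = 0)"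
    if "u \<in> dual_cone W \<sigma>" "v \<in> dual_cone W \<sigma>" for u v
  proof -
    have "u \<bullet> x \<ge> 0 \<and> v \<bullet> x \<ge> 0" if "x \<in> \<tau>" for x
      using that sub \<open>u \<in> _\<close> \<open>v \<in> _\<close> by (auto simp: dual_cone_def)
    then show ?thesis
      by (auto simp: inner_add_left add_nonneg_eq_0_iff)
  qed
  show ?thesis
    unfolding trop_hom_def p_eq
  proof (intro CollectI conjI ballI allI impI)
    show "strata_hom W \<sigma> (\<tau>, coset (span \<tau>) w) \<in> dual_cone W \<sigma> \<rightarrow>\<^sub>E {a. a \<noteq> - \<infinity>}"
    proof (rule PiE_I)
      fix u assume u: "u \<in> dual_cone W \<sigma>"
      show "strata_hom W \<sigma> (\<tau>, coset (span \<tau>) w) u \<in> {a. a \<noteq> - \<infinity>}"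
        by (simp add: strata_hom_coset[OF u])
    next
      fix u assume "u \<notin> dual_cone W \<sigma>"
      then show "strata_hom W \<sigma> (\<tau>, coset (span \<tau>) w) u = undefined"
        by (simp add: strata_hom_def)
    qed
    show "strata_hom W \<sigma> (\<tau>, coset (span \<tau>) w) 0 = 0"
      using z by (simp add: strata_hom_coset zero_ereal_def)
  next
    fix u v assume uv: "u \<in> dual_cone W \<sigma>" "v \<in> dual_cone W \<sigma>"
    show "strata_hom W \<sigma> (\<tau>, coset (span \<tau>) w) (u + v) =
        strata_hom W \<sigma> (\<tau>, coset (span \<tau>) w) u + strata_hom W \<sigma> (\<tau>, coset (span \<tau>) w) v"
      by (simp only: strata_hom_coset add[OF uv] uv perp[OF uv]) (simp add: inner_add_left)
  next
    fix u and t :: real assume u: "u \<in> dual_cone W \<sigma>" and t: "0 \<le> t"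
    show "strata_hom W \<sigma> (\<tau>, coset (span \<tau>) w) (t *\<^sub>R u) =
        ereal t * strata_hom W \<sigma> (\<tau>, coset (span \<tau>) w) u"
      using u t sc[OF u t] by (cases "t = 0") (auto simp: strata_hom_coset zero_ereal_def[symmetric])
  qed
qed

lemma topspace_affine_trop_toric:
  assumes "subspace W"
  shows "topspace (affine_trop_toric W \<sigma>) = affine_strata W \<sigma>"
proof -
  have "topspace trop_line = {a. a \<noteq> -\<infinity>}"
    by (simp add: trop_line_def topspace_pullback_topology)
  then have "topspace (trop_hom_topology W \<sigma>) =
      (dual_cone W \<sigma> \<rightarrow>\<^sub>E {a. a \<noteq> -\<infinity>}) \<inter> trop_hom W \<sigma>"
    by (simp only: trop_hom_topology_def topspace_subtopology topspace_product_topology)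
  moreover have "trop_hom W \<sigma> \<subseteq> dual_cone W \<sigma> \<rightarrow>\<^sub>E {a. a \<noteq> -\<infinity>}"
    unfolding trop_hom_def by (rule Collect_restrict)
  ultimately have "topspace (trop_hom_topology W \<sigma>) = trop_hom W \<sigma>"
    by (simp only: Int_absorb1)
  then show ?thesis
    using strata_hom_in_trop_hom[OF assms]
    unfolding affine_trop_toric_def topspace_pullback_topology by blast
qed

lemma topspace_trop_toric:
  assumes "subspace W" and "fan \<Sigma>"
  shows "topspace (trop_toric W \<Sigma>) = strata W \<Sigma>"
proof -
  have sub: "strata W \<Sigma> \<inter> affine_strata W \<sigma> = affine_strata W \<sigma>" if "\<sigma> \<in> \<Sigma>" for \<sigma>
  proof (rule Int_absorb1, rule subsetI)
    fix p assume "p \<in> affine_strata W \<sigma>"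
    then obtain \<tau> w where p: "p = (\<tau>, coset (span \<tau>) w)" "w \<in> W"
      and \<tau>: "\<tau> face_of \<sigma>" "\<tau> \<noteq> {}"
      unfolding affine_strata_def strata_def by blast
    have "polyhedral_complex \<Sigma>" using assms(2) by (simp only: fan_def)
    then have "\<forall>F. F face_of \<sigma> \<and> F \<noteq> {} \<longrightarrow> F \<in> \<Sigma>"
      unfolding polyhedral_complex_def using that by blast
    then have "\<tau> \<in> \<Sigma>" using \<tau> by blast
    then show "p \<in> strata W \<Sigma>" unfolding strata_def using p by blast
  qed
  have "openin (affine_trop_toric W \<sigma>) (affine_strata W \<sigma>)" for \<sigma>
    using openin_topspace[of "affine_trop_toric W \<sigma>"]
    by (simp add: topspace_affine_trop_toric[OF assms(1)])
  then have "openin (trop_toric W \<Sigma>) (strata W \<Sigma>)"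
    unfolding openin_trop_toric by (simp add: sub)
  then have "strata W \<Sigma> \<subseteq> topspace (trop_toric W \<Sigma>)" by (rule openin_subset)
  moreover have "topspace (trop_toric W \<Sigma>) \<subseteq> strata W \<Sigma>"
    using openin_topspace[of "trop_toric W \<Sigma>"] by (simp only: openin_trop_toric)
  ultimately show ?thesis by (rule subset_antisym[rotated])
qed

end

theory Submission
  imports Defs
begin

text \<open>
  Start from a finite completion whose recession cones form, together with \<open>\<Sigma>\<close>, a fan, and remove the
  cones outside \<open>\<Sigma>\<close> one at a time, the maximal ones first.  If \<open>\<sigma>\<close> is such a cone, choose a ray
  \<open>\<rho> = {t v | t \<ge> 0}\<close> through its relative interior and a subdivision \<open>S\<close> of \<open>\<rho>\<close> into polytopes.  A cell \<open>P\<close> with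
  \<open>rec P = \<sigma>\<close> is the union of the sums \<open>F + \<rho>\<close> over the faces \<open>F\<close> of \<open>P\<close> with \<open>rec F \<noteq> \<sigma>\<close>, and these
  sums are direct; replace \<open>P\<close> by the cells \<open>F + s\<close> with \<open>s \<in> S\<close>, whose recession cones are the proper
  faces \<open>rec F\<close> of \<open>\<sigma>\<close>.  The new cells accumulate only at the stratum of \<open>\<sigma>\<close>, which has just been removed:
  near a stratum \<open>\<tau> < \<sigma>\<close>, a linear form that vanishes on \<open>\<tau>\<close> and is positive on \<open>\<sigma> - \<tau>\<close> is bounded
  above, while it tends to infinity along \<open>F + s\<close>; near any other stratum \<open>\<tau>\<close>, a linear form separating
  \<open>\<tau>\<close> from \<open>\<sigma>\<close> keeps away from \<open>P\<close>.
\<close>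

section \<open>Recession cones and polyhedral cones\<close>

text \<open>The segment from \<open>x\<close> to a far point \<open>b + r v\<close> of
  \<open>P\<close> passes close to \<open>x + t v\<close> at parameter \<open>t / r\<close>;
  closedness gives the limit. The base point \<open>b\<close> may vary with \<open>r\<close> within
  a bounded set, as is needed for Minkowski sums.\<close>

lemma mem_rec_coneI:
  fixes P :: "'a::euclidean_space set"
  assumes P: "closed P" "convex P"
    and far: "\<And>N::real. \<exists>r\<ge>N. \<exists>b. norm b \<le> M \<and> b + r *\<^sub>R v \<in> P"
  shows "v \<in> rec_cone P"
  unfolding rec_cone_def
proof (intro CollectI ballI allI impI)
  fix x and t :: real assume x: "x \<in> P" and t: "0 \<le> t"
  have "\<exists>y\<in>P. dist y (x + t *\<^sub>R v) < e" if e: "e > 0" for e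
  proof -
    \<comment> \<open>The bound makes \<open>r\<close> positive, gives \<open>t / r \<le> 1\<close>,
      and makes the error \<open>(t / r) * norm (b - x)\<close> smaller than
      \<open>e\<close>.\<close>
    define N where "N = 1 + t + t * (\<bar>M\<bar> + norm x) / e"
    obtain r b where r: "r \<ge> N" and b: "norm b \<le> M" "b + r *\<^sub>R v \<in> P"
      using far by blast
    have "t * (\<bar>M\<bar> + norm x) / e \<ge> 0" using t e by simp
    then have r0: "r > 0" "r \<ge> t" and "r > t * (\<bar>M\<bar> + norm x) / e"
      using r t by (auto simp: N_def)
    then have rM: "t * (\<bar>M\<bar> + norm x) < e * r" using e by (simp add: field_simps)
    define y where "y = (1 - t / r) *\<^sub>R x + (t / r) *\<^sub>R (b + r *\<^sub>R v)"
    have "y \<in> P" unfolding y_def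
      using convexD[OF P(2) x b(2), of "1 - t / r" "t / r"] r0 t by simp
    moreover have "y - (x + t *\<^sub>R v) = (t / r) *\<^sub>R (b - x)"
      using r0 by (simp add: y_def algebra_simps)
    then have "dist y (x + t *\<^sub>R v) = (t / r) * norm (b - x)"
      using r0 t by (simp add: dist_norm)
    moreover have "norm (b - x) \<le> \<bar>M\<bar> + norm x"
      using norm_triangle_ineq4[of b x] b(1) by linarith
    then have "(t / r) * norm (b - x) \<le> (t / r) * (\<bar>M\<bar> + norm x)"
      using r0 t by (intro mult_left_mono) auto
    moreover have "(t / r) * (\<bar>M\<bar> + norm x) < e"
      using rM r0 by (simp add: field_simps)
    ultimately show ?thesis by force
  qed
  then show "x + t *\<^sub>R v \<in> P"
    using P(1) closed_approachable by blast
qed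

lemma rec_coneD: "v \<in> rec_cone P \<Longrightarrow> x \<in> P \<Longrightarrow> 0 \<le> t \<Longrightarrow> x + t *\<^sub>R v \<in> P"
  by (simp add: rec_cone_def)

lemma mem_rec_coneI_line:
  fixes P :: "'a::euclidean_space set"
  assumes P: "closed P" "convex P" and far: "\<And>N::real. \<exists>r\<ge>N. x + r *\<^sub>R v \<in> P"
  shows "v \<in> rec_cone P"
  by (rule mem_rec_coneI[OF P, of "norm x"]) (use far in blast)

lemma rec_cone_mono:
  fixes P :: "'a::euclidean_space set"
  assumes "closed P" "convex P" "F \<subseteq> P" "F \<noteq> {}"
  shows "rec_cone F \<subseteq> rec_cone P"
proof
  fix v assume v: "v \<in> rec_cone F"
  obtain x where x: "x \<in> F" using assms by blast
  show "v \<in> rec_cone P"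
  proof (rule mem_rec_coneI_line[OF assms(1,2), of x])
    fix N :: real
    have "x + max N 0 *\<^sub>R v \<in> P" using rec_coneD[OF v x, of "max N 0"] assms(3) by auto
    then show "\<exists>r\<ge>N. x + r *\<^sub>R v \<in> P" by (meson max.cobounded1)
  qed
qed

text \<open>For the inclusion into \<open>rec_cone F\<close>, follow a ray of the sum from
  \<open>f + s\<close>: subtracting the summand from \<open>S\<close> moves each point by a bounded
  amount into \<open>F\<close>, so \<open>mem_rec_coneI\<close> applies.\<close>

lemma rec_cone_add_bounded:
  fixes F S :: "'a::euclidean_space set"
  assumes F: "closed F" "convex F" and S: "bounded S" "S \<noteq> {}" and ne: "F \<noteq> {}"
  shows "rec_cone {x + y |x y. x \<in> F \<and> y \<in> S} = rec_cone F"
proof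
  show "rec_cone F \<subseteq> rec_cone {x + y |x y. x \<in> F \<and> y \<in> S}"
  proof
    fix v assume v: "v \<in> rec_cone F"
    show "v \<in> rec_cone {x + y |x y. x \<in> F \<and> y \<in> S}"
      unfolding rec_cone_def
    proof safe
      fix x y and t :: real assume "x \<in> F" "y \<in> S" "0 \<le> t"
      then show "\<exists>xa ya. x + y + t *\<^sub>R v = xa + ya \<and> xa \<in> F \<and> ya \<in> S"
        using rec_coneD[OF v \<open>x \<in> F\<close> \<open>0 \<le> t\<close>]
        by (intro exI[of _ "x + t *\<^sub>R v"] exI[of _ y]) (simp add: algebra_simps)
    qed
  qed
next
  obtain f s where f: "f \<in> F" and s: "s \<in> S" using ne S by blast
  obtain M where M: "\<And>y. y \<in> S \<Longrightarrow> norm y \<le> M" using S(1) unfolding bounded_iff by blast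
  show "rec_cone {x + y |x y. x \<in> F \<and> y \<in> S} \<subseteq> rec_cone F"
  proof
    fix v assume v: "v \<in> rec_cone {x + y |x y. x \<in> F \<and> y \<in> S}"
    show "v \<in> rec_cone F"
    proof (rule mem_rec_coneI[OF F, of "norm f + M + M"])
      fix N :: real
      have "f + s \<in> {x + y |x y. x \<in> F \<and> y \<in> S}" using f s by blast
      from rec_coneD[OF v this, of "max N 0"]
      obtain x y where xy: "f + s + max N 0 *\<^sub>R v = x + y" "x \<in> F" "y \<in> S" by auto
      then have "(f + s - y) + max N 0 *\<^sub>R v = x" by (simp add: algebra_simps)
      moreover have "norm (f + s - y) \<le> norm f + M + M"
        using norm_triangle_ineq4[of "f + s" y] norm_triangle_ineq[of f s] M[OF s] M[OF xy(3)]
        by linarith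
      ultimately show "\<exists>r\<ge>N. \<exists>b. norm b \<le> norm f + M + M \<and> b + r *\<^sub>R v \<in> F"
        using xy(2) by (intro exI[of _ "max N 0"]) auto
    qed
  qed
qed

section \<open>Farkas' lemma and its consequences for polyhedra and polyhedral cones\<close>

text \<open>A finitely generated cone is closed, so a point outside it can be strictly separated
  from it; minus the normal of the separating hyperplane then violates the assumption on
  \<open>u\<close>.\<close>

lemma farkas:
  fixes u :: "'a::euclidean_space"
  assumes A: "finite A" and u: "\<And>z. (\<And>a. a \<in> A \<Longrightarrow> a \<bullet> z \<le> 0) \<Longrightarrow> u \<bullet> z \<le> 0"
  shows "u \<in> convex_cone hull A"
proof (rule ccontr)
  assume "u \<notin> convex_cone hull A"
  then obtain a b where ab: "a \<bullet> u < b" "\<And>x. x \<in> convex_cone hull A \<Longrightarrow> b < a \<bullet> x"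
    using separating_hyperplane_closed_point[OF convex_convex_cone_hull closed_convex_cone_hull[OF A]]
    by blast
  have b: "b < 0" using ab(2)[OF convex_cone_hull_contains_0] by simp
  have pos: "0 \<le> a \<bullet> x" if x: "x \<in> A" for x
  proof (rule ccontr)
    assume neg: "\<not> 0 \<le> a \<bullet> x"
    \<comment> \<open>A nonnegative multiple of \<open>x\<close> would lie on the separating
      hyperplane itself, against strictness.\<close>
    then have "0 \<le> b / (a \<bullet> x)" using b by (simp add: divide_nonpos_neg)
    then have "(b / (a \<bullet> x)) *\<^sub>R x \<in> convex_cone hull A"
      by (intro convex_cone_hull_mul hull_inc x)
    from ab(2)[OF this] show False using neg by simp
  qed
  have "u \<bullet> (- a) \<le> 0"
    by (rule u) (use pos in \<open>simp add: inner_commute\<close>)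
  then show False using ab(1) b by (simp add: inner_commute)
qed

lemma polyhedron_halfspaces:
  fixes P :: "'a::euclidean_space set"
  assumes "polyhedron P"
  obtains H where "finite H" "P = {x. \<forall>(a, b)\<in>H. a \<bullet> x \<le> b}"
proof -
  obtain F where F: "finite F" "P = \<Inter>F" "\<forall>h\<in>F. \<exists>a b. a \<noteq> 0 \<and> h = {x. a \<bullet> x \<le> b}"
    using assms unfolding polyhedron_def by blast
  then obtain a b where ab: "\<And>h. h \<in> F \<Longrightarrow> h = {x. a h \<bullet> x \<le> b h}" by metis
  show thesis
  proof (rule that[of "(\<lambda>h. (a h, b h)) ` F"])
    show "finite ((\<lambda>h. (a h, b h)) ` F)" using F(1) by simp
    show "P = {x. \<forall>(a, b)\<in>(\<lambda>h. (a h, b h)) ` F. a \<bullet> x \<le> b}"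
      unfolding F(2) using ab by auto
  qed
qed

text \<open>Directions on which all the facet normals are nonpositive are recession directions.
  Hence \<open>farkas\<close> writes \<open>u\<close> as a nonnegative combination of normals, each
  of which is bounded above on \<open>P\<close>.\<close>

lemma polyhedron_bdd_above:
  fixes P :: "'a::euclidean_space set"
  assumes P: "polyhedron P" and u: "\<And>z. z \<in> rec_cone P \<Longrightarrow> u \<bullet> z \<le> 0"
  obtains c where "\<And>x. x \<in> P \<Longrightarrow> u \<bullet> x \<le> c"
proof -
  obtain H where H: "finite H" "P = {x. \<forall>(a, b)\<in>H. a \<bullet> x \<le> b}"
    using polyhedron_halfspaces[OF P] .
  have "z \<in> rec_cone P" if z: "\<And>a. a \<in> fst ` H \<Longrightarrow> a \<bullet> z \<le> 0" for z
    unfolding rec_cone_def H(2)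
  proof (clarsimp)
    fix x t a b assume "\<forall>(a, b)\<in>H. a \<bullet> x \<le> b" "(0::real) \<le> t" "(a, b) \<in> H"
    moreover from this have "a \<bullet> z \<le> 0" by (intro z) force
    ultimately have "a \<bullet> x \<le> b" "t * (a \<bullet> z) \<le> 0"
      by (auto simp: mult_nonneg_nonpos)
    then show "a \<bullet> (x + t *\<^sub>R z) \<le> b" by (simp add: inner_add_right)
  qed
  then have "u \<in> convex_cone hull (fst ` H)"
    using H(1) u by (intro farkas) auto
  moreover have "convex_cone {u. \<exists>c. \<forall>x\<in>P. u \<bullet> x \<le> c}"
    unfolding convex_cone_iff
  proof (intro conjI ballI allI impI)
    show "0 \<in> {u. \<exists>c. \<forall>x\<in>P. u \<bullet> x \<le> c}" by auto
  next
    fix u v assume "u \<in> {u. \<exists>c. \<forall>x\<in>P. u \<bullet> x \<le> c}" "v \<in> {u. \<exists>c. \<forall>x\<in>P. u \<bullet> x \<le> c}"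
    then obtain c d where "\<forall>x\<in>P. u \<bullet> x \<le> c" "\<forall>x\<in>P. v \<bullet> x \<le> d" by blast
    then show "u + v \<in> {u. \<exists>c. \<forall>x\<in>P. u \<bullet> x \<le> c}"
      by (auto intro!: exI[of _ "c + d"] simp: inner_add_left add_mono)
  next
    fix u and t :: real assume "u \<in> {u. \<exists>c. \<forall>x\<in>P. u \<bullet> x \<le> c}" and t: "0 \<le> t"
    then obtain c where "\<forall>x\<in>P. u \<bullet> x \<le> c" by blast
    then show "t *\<^sub>R u \<in> {u. \<exists>c. \<forall>x\<in>P. u \<bullet> x \<le> c}"
      using t by (auto intro!: exI[of _ "t * c"] mult_left_mono)
  qed
  then have "convex_cone hull (fst ` H) \<subseteq> {u. \<exists>c. \<forall>x\<in>P. u \<bullet> x \<le> c}"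
    by (rule hull_minimal[rotated]) (fastforce simp: H(2))
  ultimately show thesis using that by blast
qed

text \<open>All bounds \<open>b\<close> are nonnegative because 0 lies in the cone, and scaling a
  point with \<open>a \<bullet> x > 0\<close> would exceed \<open>b\<close>; so every bound can be
  replaced by 0.\<close>

lemma polyhedral_cone_halfspaces:
  fixes \<sigma> :: "'a::euclidean_space set"
  assumes "polyhedron \<sigma>" "cone \<sigma>" "\<sigma> \<noteq> {}"
  obtains A where "finite A" "\<sigma> = {x. \<forall>a\<in>A. a \<bullet> x \<le> 0}"
proof -
  obtain H where H: "finite H" "\<sigma> = {x. \<forall>(a, b)\<in>H. a \<bullet> x \<le> b}"
    using polyhedron_halfspaces[OF assms(1)] .
  have "0 \<in> \<sigma>" using assms(2,3) by (simp add: cone_contains_0)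
  then have b: "0 \<le> b" if "(a, b) \<in> H" for a b using H(2) that by fastforce
  have le: "a \<bullet> x \<le> 0" if ab: "(a, b) \<in> H" and x: "x \<in> \<sigma>" for a b x
  proof (rule ccontr)
    assume pos: "\<not> a \<bullet> x \<le> 0"
    then have "((b + 1) / (a \<bullet> x)) *\<^sub>R x \<in> \<sigma>"
      using assms(2) x b[OF ab] unfolding cone_def by (simp add: divide_nonneg_pos)
    then have "a \<bullet> (((b + 1) / (a \<bullet> x)) *\<^sub>R x) \<le> b" using H(2) ab by blast
    then show False using pos by simp
  qed
  show thesis
  proof (rule that[of "fst ` H"])
    show "finite (fst ` H)" using H(1) by simp
    show "\<sigma> = {x. \<forall>a\<in>fst ` H. a \<bullet> x \<le> 0}"
    proof
      show "\<sigma> \<subseteq> {x. \<forall>a\<in>fst ` H. a \<bullet> x \<le> 0}" using le by auto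
      show "{x. \<forall>a\<in>fst ` H. a \<bullet> x \<le> 0} \<subseteq> \<sigma>"
        unfolding H(2) using b by (force intro: order_trans)
    qed
  qed
qed

text \<open>The polar of an intersection is the sum of the polars: \<open>farkas\<close> puts
  \<open>e\<close> into the cone spanned by the normals of both cones, which is the sum of the two
  separate hulls.\<close>

lemma polar_Int_polyhedral_cones:
  fixes \<sigma> \<tau> :: "'a::euclidean_space set"
  assumes "polyhedron \<sigma>" "cone \<sigma>" "\<sigma> \<noteq> {}" and "polyhedron \<tau>" "cone \<tau>" "\<tau> \<noteq> {}"
    and e: "\<And>x. x \<in> \<sigma> \<inter> \<tau> \<Longrightarrow> e \<bullet> x \<le> 0"
  obtains u w where "e = u + w" "\<And>x. x \<in> \<sigma> \<Longrightarrow> u \<bullet> x \<le> 0" "\<And>x. x \<in> \<tau> \<Longrightarrow> w \<bullet> x \<le> 0"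
proof -
  obtain A where A: "finite A" "\<sigma> = {x. \<forall>a\<in>A. a \<bullet> x \<le> 0}"
    using polyhedral_cone_halfspaces[OF assms(1-3)] .
  obtain B where B: "finite B" "\<tau> = {x. \<forall>a\<in>B. a \<bullet> x \<le> 0}"
    using polyhedral_cone_halfspaces[OF assms(4-6)] .
  have "e \<in> convex_cone hull (A \<union> B)"
    by (rule farkas) (use A B e in auto)
  then obtain u w where uw: "e = u + w" "u \<in> convex_cone hull A" "w \<in> convex_cone hull B"
    unfolding convex_cone_hull_Un by blast
  have polar: "convex_cone hull C \<subseteq> {u. u \<bullet> x \<le> 0}" if "\<And>a. a \<in> C \<Longrightarrow> a \<bullet> x \<le> 0" for C x
    using that convex_cone_halfspace_le[of x] by (intro hull_minimal) (auto simp: inner_commute)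
  show thesis
  proof (rule that[OF uw(1)])
    show "u \<bullet> x \<le> 0" if "x \<in> \<sigma>" for x using polar[of A x] that uw(2) A(2) by auto
    show "w \<bullet> x \<le> 0" if "x \<in> \<tau>" for x using polar[of B x] that uw(3) B(2) by auto
  qed
qed

text \<open>A supporting hyperplane of a cone at a nonempty face passes through the origin: compare
  a point \<open>x\<close> of the face with \<open>0 x\<close> and \<open>2 x\<close>.\<close>

lemma polyhedral_cone_face_exposed:
  fixes \<sigma> :: "'a::euclidean_space set"
  assumes \<sigma>: "polyhedron \<sigma>" "cone \<sigma>" and \<tau>: "\<tau> face_of \<sigma>" "\<tau> \<noteq> {}"
  obtains m where "\<And>x. x \<in> \<sigma> \<Longrightarrow> 0 \<le> m \<bullet> x" "\<tau> = {x\<in>\<sigma>. m \<bullet> x = 0}"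
proof -
  obtain a b where ab: "\<And>x. x \<in> \<sigma> \<Longrightarrow> a \<bullet> x \<le> b" "\<tau> = {x\<in>\<sigma>. a \<bullet> x = b}"
    using exposed_face_of_polyhedron[OF \<sigma>(1), of \<tau>] \<tau>(1) unfolding exposed_face_of_def by blast
  obtain x where x: "x \<in> \<sigma>" "a \<bullet> x = b" using \<tau>(2) ab(2) by blast
  have cx: "t *\<^sub>R x \<in> \<sigma>" if "0 \<le> t" for t using \<sigma>(2) x(1) that by (simp add: cone_def)
  have "a \<bullet> (0 *\<^sub>R x) \<le> b" "a \<bullet> (2 *\<^sub>R x) \<le> b"
    using ab(1)[OF cx[of 0]] ab(1)[OF cx[of 2]] by simp_all
  then have "b = 0" using x by simp
  show thesis by (rule that[of "-a"]) (use ab \<open>b = 0\<close> in auto)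
qed

text \<open>This is the algebra behind gluing charts: a form nonnegative on the face
  \<open>m = 0\<close> becomes nonnegative on the whole cone after adding a multiple of
  \<open>m\<close>. The slice \<open>m \<le> 1\<close> has its recession directions in that face, so
  \<open>-u\<close> is bounded above on it, and homogeneity does the rest.\<close>

lemma nonneg_on_face_shift:
  fixes \<sigma> :: "'a::euclidean_space set"
  assumes \<sigma>: "polyhedron \<sigma>" "cone \<sigma>" and ne: "\<sigma> \<noteq> {}"
    and m: "\<And>x. x \<in> \<sigma> \<Longrightarrow> 0 \<le> m \<bullet> x"
    and u: "\<And>x. x \<in> \<sigma> \<Longrightarrow> m \<bullet> x = 0 \<Longrightarrow> 0 \<le> u \<bullet> x"
  obtains k where "0 \<le> k" "\<And>x. x \<in> \<sigma> \<Longrightarrow> 0 \<le> (u + k *\<^sub>R m) \<bullet> x"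
proof -
  define P where "P = \<sigma> \<inter> {x. m \<bullet> x \<le> 1}"
  have P: "polyhedron P" unfolding P_def using \<sigma>(1) by (simp add: polyhedron_halfspace_le)
  have "(-u) \<bullet> z \<le> 0" if z: "z \<in> rec_cone P" for z
  proof -
    have "0 \<in> P" using \<sigma>(2) ne by (simp add: P_def cone_contains_0)
    then have tz: "t *\<^sub>R z \<in> P" if "0 \<le> t" for t using rec_coneD[OF z, of 0 t] that by simp
    have z\<sigma>: "z \<in> \<sigma>" using tz[of 1] by (simp add: P_def)
    have "m \<bullet> z = 0"
    proof (rule ccontr)
      assume "m \<bullet> z \<noteq> 0"
      then have "m \<bullet> z > 0" using m[OF z\<sigma>] by simp
      then have "m \<bullet> ((2 / (m \<bullet> z)) *\<^sub>R z) \<le> 1"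
        using tz[of "2 / (m \<bullet> z)"] by (simp add: P_def)
      then show False using \<open>m \<bullet> z \<noteq> 0\<close> by simp
    qed
    then show ?thesis using u[OF z\<sigma>] by simp
  qed
  then obtain c where c: "\<And>x. x \<in> P \<Longrightarrow> (-u) \<bullet> x \<le> c" using polyhedron_bdd_above[OF P] by blast
  show thesis
  proof (rule that[of "max c 0"])
    fix x assume x: "x \<in> \<sigma>"
    show "0 \<le> (u + max c 0 *\<^sub>R m) \<bullet> x"
    proof (cases "m \<bullet> x = 0")
      case True then show ?thesis using u[OF x] by (simp add: inner_add_left)
    next
      case False
      then have mx: "m \<bullet> x > 0" using m[OF x] by simp
      then have "(1 / (m \<bullet> x)) *\<^sub>R x \<in> P" using x \<sigma>(2) by (simp add: P_def cone_def)
      from c[OF this] have "- (u \<bullet> x) \<le> c * (m \<bullet> x)" using mx by (simp add: field_simps)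
      also have "\<dots> \<le> max c 0 * (m \<bullet> x)" using mx by (intro mult_right_mono) auto
      finally show ?thesis by (simp add: inner_add_left)
    qed
  qed simp
qed

section \<open>Open subsets of tropical toric varieties\<close>

text \<open>The map \<open>ereal_exp_minus\<close> reverses the order and sends infinity to 0, so
  both sets are preimages of open half-lines; the second one contains infinity.\<close>

lemma openin_trop_line:
  shows "openin trop_line {a. a \<noteq> -\<infinity> \<and> a < ereal s}"
    and "openin trop_line {a. a \<noteq> -\<infinity> \<and> ereal s < a}"
proof -
  have "{a. a \<noteq> -\<infinity> \<and> a < ereal s} = ereal_exp_minus -` {exp (- s)<..} \<inter> {a. a \<noteq> -\<infinity>}"
  proof (intro set_eqI)
    fix a show "a \<in> {a. a \<noteq> -\<infinity> \<and> a < ereal s} \<longleftrightarrow>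
        a \<in> ereal_exp_minus -` {exp (- s)<..} \<inter> {a. a \<noteq> -\<infinity>}"
      by (cases a) (auto simp: ereal_exp_minus_def)
  qed
  then show "openin trop_line {a. a \<noteq> -\<infinity> \<and> a < ereal s}"
    unfolding trop_line_def openin_pullback_topology
    by (intro exI[of _ "{exp (- s)<..}"]) auto
  have "{a. a \<noteq> -\<infinity> \<and> ereal s < a} = ereal_exp_minus -` {..<exp (- s)} \<inter> {a. a \<noteq> -\<infinity>}"
  proof (intro set_eqI)
    fix a show "a \<in> {a. a \<noteq> -\<infinity> \<and> ereal s < a} \<longleftrightarrow>
        a \<in> ereal_exp_minus -` {..<exp (- s)} \<inter> {a. a \<noteq> -\<infinity>}"
      by (cases a) (auto simp: ereal_exp_minus_def)
  qed
  then show "openin trop_line {a. a \<noteq> -\<infinity> \<and> ereal s < a}"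
    unfolding trop_line_def openin_pullback_topology
    by (intro exI[of _ "{..<exp (- s)}"]) auto
qed

lemma openin_affine_trop_toric_coordinate:
  assumes W: "subspace W" and u: "u \<in> dual_cone W \<sigma>" and U: "openin trop_line U"
  shows "openin (affine_trop_toric W \<sigma>) {p \<in> affine_strata W \<sigma>. strata_hom W \<sigma> p u \<in> U}"
proof -
  define T where "T = product_topology (\<lambda>_. trop_line) (dual_cone W \<sigma>)"
  have "continuous_map T trop_line (\<lambda>\<phi>. \<phi> u)"
    unfolding T_def by (rule continuous_map_product_projection[OF u])
  then have "openin T {\<phi> \<in> topspace T. \<phi> u \<in> U}"
    using U by (rule openin_continuous_map_preimage)
  then have "openin (trop_hom_topology W \<sigma>) ({\<phi> \<in> topspace T. \<phi> u \<in> U} \<inter> trop_hom W \<sigma>)"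
    unfolding trop_hom_topology_def T_def[symmetric] by (rule openin_subtopology_Int)
  moreover have "strata_hom W \<sigma> p \<in> topspace T" if "p \<in> affine_strata W \<sigma>" for p
  proof -
    have "topspace trop_line = {a. a \<noteq> -\<infinity>}"
      by (simp add: trop_line_def topspace_pullback_topology)
    then have "trop_hom W \<sigma> \<subseteq> topspace T"
      unfolding T_def topspace_product_topology trop_hom_def by blast
    then show ?thesis using strata_hom_in_trop_hom[OF W that] by blast
  qed
  then have "{p \<in> affine_strata W \<sigma>. strata_hom W \<sigma> p u \<in> U} =
      strata_hom W \<sigma> -` ({\<phi> \<in> topspace T. \<phi> u \<in> U} \<inter> trop_hom W \<sigma>) \<inter> affine_strata W \<sigma>"
    using strata_hom_in_trop_hom[OF W] by blast
  ultimately show ?thesis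
    unfolding affine_trop_toric_def openin_pullback_topology by blast
qed

section \<open>Coordinates on strata and basic facts on fans\<close>

lemma coset_span_self: "a \<in> coset (span \<gamma>) a"
  unfolding coset_def using span_zero[of \<gamma>] by force

lemma coset_span_inner:
  fixes u :: "'a::euclidean_space"
  assumes "coset (span \<gamma>) a = coset (span \<gamma>) a'" and "\<forall>x\<in>\<gamma>. u \<bullet> x = 0"
  shows "u \<bullet> a = u \<bullet> a'"
proof -
  have "a \<in> coset (span \<gamma>) a'"
    by (rule subst[OF assms(1), of "\<lambda>A. a \<in> A"]) (rule coset_span_self)
  then have "\<exists>v. v \<in> span \<gamma> \<and> a = a' + v"
    unfolding coset_def by fast
  then obtain v where v: "v \<in> span \<gamma>" "a = a' + v" by (elim exE conjE)
  have "orthogonal u v"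
    by (rule orthogonal_to_span[OF v(1)]) (simp add: orthogonal_def assms(2))
  then have "u \<bullet> v = 0" by (simp only: orthogonal_def)
  then show ?thesis by (simp add: v(2) inner_add_right)
qed

text \<open>Chart coordinates are indexed by vectors of \<open>W\<close>. Orthogonal projection
  replaces an ambient form by such a vector without changing its values on \<open>W\<close>.\<close>

lemma subspace_representative:
  fixes u :: "'a::euclidean_space"
  assumes "subspace W"
  obtains u' where "u' \<in> W" "\<And>x. x \<in> W \<Longrightarrow> u' \<bullet> x = u \<bullet> x"
proof -
  obtain y z where yz: "y \<in> span W" "\<And>w. w \<in> span W \<Longrightarrow> orthogonal z w" "u = y + z"
    using orthogonal_subspace_decomp_exists[of W u] by blast
  show thesis
  proof (rule that)
    have W: "span W = W" using assms by (simp add: span_eq_iff)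
    show "y \<in> W" using yz(1) W by simp
    show "y \<bullet> x = u \<bullet> x" if "x \<in> W" for x
      using yz(2)[of x] yz(3) that W by (simp add: inner_add_left orthogonal_def)
  qed
qed

text \<open>
  The part of the chart of \<open>\<tau>\<close> on which the coordinate \<open>u\<close>, nonnegative on \<open>\<tau>\<close>, exceeds \<open>c\<close>;
  on strata along which \<open>u\<close> does not vanish, its value is \<open>\<infinity>\<close>.
\<close>

definition trop_halfspace ::
  "'a::euclidean_space set \<Rightarrow> 'a set \<Rightarrow> 'a \<Rightarrow> real \<Rightarrow> ('a set \<times> 'a set) set" where
  "trop_halfspace W \<tau> u c = {(\<gamma>, coset (span \<gamma>) a) |\<gamma> a.
     \<gamma> face_of \<tau> \<and> \<gamma> \<noteq> {} \<and> a \<in> W \<and> ((\<forall>x\<in>\<gamma>. u \<bullet> x = 0) \<longrightarrow> c < u \<bullet> a)}"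

lemma mem_trop_halfspace:
  "(\<gamma>, coset (span \<gamma>) a) \<in> trop_halfspace W \<tau> u c \<longleftrightarrow>
     \<gamma> face_of \<tau> \<and> \<gamma> \<noteq> {} \<and> ((\<forall>x\<in>\<gamma>. u \<bullet> x = 0) \<longrightarrow> c < u \<bullet> a)"
  if a: "a \<in> W"
proof
  assume "(\<gamma>, coset (span \<gamma>) a) \<in> trop_halfspace W \<tau> u c"
  then obtain a' where a': "coset (span \<gamma>) a = coset (span \<gamma>) a'" "\<gamma> face_of \<tau>" "\<gamma> \<noteq> {}"
    "(\<forall>x\<in>\<gamma>. u \<bullet> x = 0) \<longrightarrow> c < u \<bullet> a'"
    unfolding trop_halfspace_def by blast
  then show "\<gamma> face_of \<tau> \<and> \<gamma> \<noteq> {} \<and> ((\<forall>x\<in>\<gamma>. u \<bullet> x = 0) \<longrightarrow> c < u \<bullet> a)"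
    using coset_span_inner[OF a'(1)] by simp
next
  assume "\<gamma> face_of \<tau> \<and> \<gamma> \<noteq> {} \<and> ((\<forall>x\<in>\<gamma>. u \<bullet> x = 0) \<longrightarrow> c < u \<bullet> a)"
  then show "(\<gamma>, coset (span \<gamma>) a) \<in> trop_halfspace W \<tau> u c"
    using a unfolding trop_halfspace_def by blast
qed

lemma polyhedral_complexD:
  assumes "polyhedral_complex \<Phi>" and "P \<in> \<Phi>"
  shows "polyhedron P" "P \<noteq> {}"
    and "\<And>F. F face_of P \<Longrightarrow> F \<noteq> {} \<Longrightarrow> F \<in> \<Phi>"
    and "\<And>Q. Q \<in> \<Phi> \<Longrightarrow> (P \<inter> Q) face_of P"
    and "\<And>Q. Q \<in> \<Phi> \<Longrightarrow> (P \<inter> Q) face_of Q"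
proof -
  note c = assms(1)[unfolded polyhedral_complex_def]
  show "polyhedron P" "P \<noteq> {}" using bspec[OF conjunct1[OF c] assms(2)] by blast+
  show "F \<in> \<Phi>" if "F face_of P" "F \<noteq> {}" for F
    using bspec[OF conjunct1[OF conjunct2[OF c]] assms(2)] that by blast
  show "(P \<inter> Q) face_of P" "(P \<inter> Q) face_of Q" if "Q \<in> \<Phi>" for Q
    using bspec[OF bspec[OF conjunct2[OF conjunct2[OF c]] assms(2)] that] by blast+
qed

lemma fanD: "fan \<Sigma> \<Longrightarrow> polyhedral_complex \<Sigma>"
  by (simp only: fan_def)

lemma fan_Int_face:
  assumes "fan \<Sigma>" "\<sigma> \<in> \<Sigma>" "\<tau> \<in> \<Sigma>"
  shows "(\<sigma> \<inter> \<tau>) face_of \<sigma>" "(\<sigma> \<inter> \<tau>) face_of \<tau>"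
  using polyhedral_complexD(4,5)[OF fanD] assms by blast+

lemma fan_face: "fan \<Sigma> \<Longrightarrow> \<sigma> \<in> \<Sigma> \<Longrightarrow> \<tau> face_of \<sigma> \<Longrightarrow> \<tau> \<noteq> {} \<Longrightarrow> \<tau> \<in> \<Sigma>"
  by (rule polyhedral_complexD(3)[OF fanD])

lemma fan_cone:
  assumes "fan \<Sigma>" "\<sigma> \<in> \<Sigma>"
  shows "polyhedron \<sigma>" "\<sigma> \<noteq> {}" "cone \<sigma>" "0 \<in> \<sigma>" "\<And>x. x \<in> \<sigma> \<Longrightarrow> - x \<in> \<sigma> \<Longrightarrow> x = 0"
proof -
  show \<sigma>: "polyhedron \<sigma>" "\<sigma> \<noteq> {}"
    by (rule polyhedral_complexD[OF fanD[OF assms(1)] assms(2)])+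
  show c: "cone \<sigma>" using assms by (simp add: fan_def pointed_cone_def)
  show "0 \<in> \<sigma>" using \<sigma>(2) c by (simp add: cone_contains_0)
  have "\<forall>x. x \<in> \<sigma> \<and> - x \<in> \<sigma> \<longrightarrow> x = 0"
    using assms unfolding fan_def pointed_cone_def by blast
  then show "x = 0" if "x \<in> \<sigma>" "- x \<in> \<sigma>" for x using that by blast
qed

text \<open>If 0 were strictly between \<open>a\<close> and \<open>b\<close>, a positive multiple of
  \<open>a\<close> and its negative would both lie in the cone, against pointedness.\<close>

lemma fan_zero:
  assumes \<Sigma>: "fan \<Sigma>" and \<sigma>: "\<sigma> \<in> \<Sigma>"
  shows "{0} face_of \<sigma>"
  unfolding face_of_singleton extreme_point_of_def
proof (intro conjI ballI)
  note c = fan_cone[OF \<Sigma> \<sigma>]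
  show "0 \<in> \<sigma>" by (rule c)
  fix a b assume ab: "a \<in> \<sigma>" "b \<in> \<sigma>"
  show "0 \<notin> open_segment a b"
  proof
    assume "0 \<in> open_segment a b"
    then obtain t where t: "a \<noteq> b" "0 < t" "t < 1" "0 = (1 - t) *\<^sub>R a + t *\<^sub>R b"
      by (auto simp: in_segment)
    have "(1 - t) *\<^sub>R a \<in> \<sigma>" "t *\<^sub>R b \<in> \<sigma>"
      using c(3) ab t by (auto simp: cone_def)
    moreover have "t *\<^sub>R b = - ((1 - t) *\<^sub>R a)"
      using t(4)[symmetric] by (simp only: eq_neg_iff_add_eq_0 add.commute)
    ultimately have "(1 - t) *\<^sub>R a \<in> \<sigma>" "- ((1 - t) *\<^sub>R a) \<in> \<sigma>" by simp_all
    then have "(1 - t) *\<^sub>R a = 0" by (rule c(5))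
    then have "a = 0" "b = 0" using t(2-4) by simp_all
    then show False using t(1) by simp
  qed
qed

text \<open>Openness has to be tested in every chart \<sigma>, where \<open>u\<close> may be
  negative and hence no coordinate. Let \<open>m\<close> cut out
  \<open>\<sigma> \<inter> \<tau>\<close> in \<sigma>; then \<open>q = u' + k m\<close> is a
  coordinate on \<sigma>, and the condition on \<open>u\<close> can be expressed through
  \<open>q\<close> and \<open>m\<close> wherever \<open>m\<close> is finite.\<close>

lemma openin_trop_halfspace:
  fixes W :: "'a::euclidean_space set"
  assumes W: "subspace W" and \<Sigma>: "fan \<Sigma>" "\<And>\<sigma>. \<sigma> \<in> \<Sigma> \<Longrightarrow> \<sigma> \<subseteq> W"
    and \<tau>: "\<tau> \<in> \<Sigma>" and u: "\<And>x. x \<in> \<tau> \<Longrightarrow> 0 \<le> u \<bullet> x"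
  shows "openin (trop_toric W \<Sigma>) (trop_halfspace W \<tau> u c)"
  unfolding openin_trop_toric
proof (intro conjI ballI)
  show "trop_halfspace W \<tau> u c \<subseteq> strata W \<Sigma>"
    using fan_face[OF \<Sigma>(1) \<tau>] unfolding trop_halfspace_def strata_def by blast
next
  fix \<sigma> assume \<sigma>: "\<sigma> \<in> \<Sigma>"
  note c\<sigma> = fan_cone[OF \<Sigma>(1) \<sigma>]
  have \<delta>: "(\<sigma> \<inter> \<tau>) face_of \<sigma>" "(\<sigma> \<inter> \<tau>) face_of \<tau>" "0 \<in> \<sigma> \<inter> \<tau>"
    using fan_Int_face[OF \<Sigma>(1) \<sigma> \<tau>] fan_cone(4)[OF \<Sigma>(1)] \<sigma> \<tau> by blast+
  obtain m0 where m0: "\<And>x. x \<in> \<sigma> \<Longrightarrow> 0 \<le> m0 \<bullet> x" "\<sigma> \<inter> \<tau> = {x\<in>\<sigma>. m0 \<bullet> x = 0}"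
    using polyhedral_cone_face_exposed[OF c\<sigma>(1,3) \<delta>(1)] \<delta>(3) by blast
  obtain m where m: "m \<in> W" "\<And>x. x \<in> W \<Longrightarrow> m \<bullet> x = m0 \<bullet> x"
    using subspace_representative[OF W] by blast
  have m\<sigma>: "\<And>x. x \<in> \<sigma> \<Longrightarrow> 0 \<le> m \<bullet> x" "\<sigma> \<inter> \<tau> = {x\<in>\<sigma>. m \<bullet> x = 0}"
    using m0 m(2) \<Sigma>(2)[OF \<sigma>] by auto
  obtain u' where u': "u' \<in> W" "\<And>x. x \<in> W \<Longrightarrow> u' \<bullet> x = u \<bullet> x"
    using subspace_representative[OF W] by blast
  have "0 \<le> u' \<bullet> x" if "x \<in> \<sigma>" "m \<bullet> x = 0" for x
  proof -
    have "x \<in> \<tau>" using m\<sigma>(2) that by blast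
    then show ?thesis using u u' \<Sigma>(2)[OF \<tau>] by auto
  qed
  then obtain k where k: "0 \<le> k" "\<And>x. x \<in> \<sigma> \<Longrightarrow> 0 \<le> (u' + k *\<^sub>R m) \<bullet> x"
    using nonneg_on_face_shift[OF c\<sigma>(1,3,2) m\<sigma>(1), of u'] by blast
  define q where "q = u' + k *\<^sub>R m"
  have md: "m \<in> dual_cone W \<sigma>" using m m\<sigma> by (simp add: dual_cone_def)
  have qd: "q \<in> dual_cone W \<sigma>"
    using k(2) W m(1) u'(1) by (simp add: dual_cone_def q_def subspace_add subspace_scale)
  \<comment> \<open>The condition \<open>m < s\<close> forces \<open>m\<close> to be finite, and
    together with \<open>q > c + k s\<close> it gives \<open>u > c\<close> because
    \<open>k \<ge> 0\<close>. Letting \<open>s\<close> approach \<open>m\<close> from above recovers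
    all points with \<open>u > c\<close>.\<close>
  define Q where "Q s = {p \<in> affine_strata W \<sigma>. strata_hom W \<sigma> p m \<in> {a. a \<noteq> -\<infinity> \<and> a < ereal s}} \<inter>
    {p \<in> affine_strata W \<sigma>. strata_hom W \<sigma> p q \<in> {a. a \<noteq> -\<infinity> \<and> ereal (c + k * s) < a}}" for s
  have "openin (affine_trop_toric W \<sigma>) (Q s)" for s
    unfolding Q_def
    by (intro openin_Int openin_affine_trop_toric_coordinate[OF W] md qd openin_trop_line)
  then have "openin (affine_trop_toric W \<sigma>) (\<Union>s. Q s)" by blast
  moreover have "trop_halfspace W \<tau> u c \<inter> affine_strata W \<sigma> = (\<Union>s. Q s)"
  proof -
    have "p \<in> trop_halfspace W \<tau> u c \<longleftrightarrow> p \<in> (\<Union>s. Q s)" if p: "p \<in> affine_strata W \<sigma>" for p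
    proof -
      obtain \<gamma> a where \<gamma>: "p = (\<gamma>, coset (span \<gamma>) a)" "\<gamma> face_of \<sigma>" "\<gamma> \<noteq> {}" "a \<in> W"
        using p unfolding affine_strata_def strata_def by blast
      have \<gamma>W: "\<gamma> \<subseteq> \<sigma>" "\<gamma> \<subseteq> W" using face_of_imp_subset[OF \<gamma>(2)] \<Sigma>(2)[OF \<sigma>] by auto
      \<comment> \<open>A stratum of the chart of \<sigma> belongs to the chart of \<tau> exactly
        when \<open>m\<close> is finite on it.\<close>
      have "\<gamma> face_of \<tau> \<longleftrightarrow> \<gamma> \<subseteq> \<sigma> \<inter> \<tau>"
        using \<gamma>(2) \<delta>(1,2) by (meson face_of_face face_of_imp_subset le_infI)
      also have "\<dots> \<longleftrightarrow> (\<forall>x\<in>\<gamma>. m \<bullet> x = 0)" using m\<sigma>(2) \<gamma>W by blast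
      finally have face: "\<gamma> face_of \<tau> \<longleftrightarrow> (\<forall>x\<in>\<gamma>. m \<bullet> x = 0)" .
      have "p \<in> (\<Union>s. Q s) \<longleftrightarrow> (\<exists>s. (\<forall>x\<in>\<gamma>. m \<bullet> x = 0) \<and> m \<bullet> a < s \<and>
          ((\<forall>x\<in>\<gamma>. q \<bullet> x = 0) \<longrightarrow> c + k * s < q \<bullet> a))"
        using p \<gamma>(4) by (auto simp: Q_def \<gamma>(1) strata_hom_coset[OF md] strata_hom_coset[OF qd])
      also have "\<dots> \<longleftrightarrow> (\<forall>x\<in>\<gamma>. m \<bullet> x = 0) \<and> (\<exists>s. m \<bullet> a < s \<and>
          ((\<forall>x\<in>\<gamma>. u \<bullet> x = 0) \<longrightarrow> c + k * s < u \<bullet> a + k * (m \<bullet> a)))"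
      proof -
        have "q \<bullet> a = u \<bullet> a + k * (m \<bullet> a)" using u'(2)[OF \<gamma>(4)] by (simp add: q_def inner_add_left)
        moreover have "q \<bullet> x = u \<bullet> x" if "m \<bullet> x = 0" "x \<in> \<gamma>" for x
          using u'(2) \<gamma>W that by (auto simp: q_def inner_add_left)
        ultimately show ?thesis by force
      qed
      also have "\<dots> \<longleftrightarrow> (\<forall>x\<in>\<gamma>. m \<bullet> x = 0) \<and> ((\<forall>x\<in>\<gamma>. u \<bullet> x = 0) \<longrightarrow> c < u \<bullet> a)"
      proof -
        have "(\<exists>s. m \<bullet> a < s \<and> c + k * s < u \<bullet> a + k * (m \<bullet> a)) \<longleftrightarrow> c < u \<bullet> a"
        proof
          assume "\<exists>s. m \<bullet> a < s \<and> c + k * s < u \<bullet> a + k * (m \<bullet> a)"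
          then obtain s where "m \<bullet> a < s" "c + k * s < u \<bullet> a + k * (m \<bullet> a)" by blast
          moreover have "k * (m \<bullet> a) \<le> k * s" using k(1) calculation(1) by (intro mult_left_mono) auto
          ultimately show "c < u \<bullet> a" by linarith
        next
          assume c: "c < u \<bullet> a"
          \<comment> \<open>The denominator \<open>k + 1\<close> also covers \<open>k = 0\<close>
            and leaves \<open>k * e\<close> strictly below the available gap.\<close>
          define e where "e = (u \<bullet> a - c) / (k + 1)"
          have "e > 0" "k * e < u \<bullet> a - c" using c k(1) by (auto simp: e_def field_simps)
          then show "\<exists>s. m \<bullet> a < s \<and> c + k * s < u \<bullet> a + k * (m \<bullet> a)"
            by (intro exI[of _ "m \<bullet> a + e"]) (simp add: algebra_simps)
        qed
        moreover have "\<exists>s. m \<bullet> a < s" by (rule gt_ex)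
        ultimately show ?thesis by blast
      qed
      also have "\<dots> \<longleftrightarrow> p \<in> trop_halfspace W \<tau> u c"
        unfolding \<gamma>(1) mem_trop_halfspace[OF \<gamma>(4)] using face \<gamma>(3) by blast
      finally show ?thesis by blast
    qed
    moreover have "(\<Union>s. Q s) \<subseteq> affine_strata W \<sigma>" by (auto simp: Q_def)
    ultimately show ?thesis by blast
  qed
  ultimately show "openin (affine_trop_toric W \<sigma>) (trop_halfspace W \<tau> u c \<inter> affine_strata W \<sigma>)"
    by simp
qed

lemma openin_trop_chart:
  fixes W :: "'a::euclidean_space set"
  assumes W: "subspace W" and \<Sigma>: "fan \<Sigma>" "\<And>\<sigma>. \<sigma> \<in> \<Sigma> \<Longrightarrow> \<sigma> \<subseteq> W" and \<tau>: "\<tau> \<in> \<Sigma>"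
  shows "openin (trop_toric W \<Sigma>) (affine_strata W \<tau>)"
proof -
  \<comment> \<open>For the zero form the condition reads \<open>-1 < 0\<close>, so nothing is cut
    off.\<close>
  have "affine_strata W \<tau> = trop_halfspace W \<tau> 0 (-1)"
    by (auto simp: affine_strata_def strata_def trop_halfspace_def)
  then show ?thesis using openin_trop_halfspace[OF assms, of 0 "-1"] by simp
qed

text \<open>
  Local finiteness at the points of \<open>W(\<Sigma>)\<close>, tested on the basic neighbourhoods cut out by finitely
  many coordinates \<open>u\<close> that are required to exceed a bound \<open>c\<close>.
\<close>

definition trop_locally_finite ::
  "'a::euclidean_space set \<Rightarrow> 'a set set \<Rightarrow> 'a set set \<Rightarrow> bool" where
  "trop_locally_finite W \<Sigma> \<Psi> \<longleftrightarrow> (\<forall>\<tau>\<in>\<Sigma>. \<forall>w\<in>W. \<exists>I. finite I \<and>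
     (\<forall>(u, c)\<in>I. (\<forall>x\<in>\<tau>. 0 \<le> u \<bullet> x) \<and> ((\<forall>x\<in>\<tau>. u \<bullet> x = 0) \<longrightarrow> c < u \<bullet> w)) \<and>
     finite {P\<in>\<Psi>. \<exists>y\<in>P. \<forall>(u, c)\<in>I. c < u \<bullet> y})"

text \<open>Each pair in \<open>I\<close> describes an open set around the given point. On the
  stratum of \<open>{0}\<close>, where the cells live, every form vanishes on the cone, so
  membership is just the inequality \<open>c < u \<bullet> y\<close>.\<close>

lemma locally_finite_in_trop_toric:
  fixes W :: "'a::euclidean_space set"
  assumes W: "subspace W" and \<Sigma>: "fan \<Sigma>" "\<And>\<sigma>. \<sigma> \<in> \<Sigma> \<Longrightarrow> \<sigma> \<subseteq> W"
    and \<Psi>: "\<Union>\<Psi> \<subseteq> W" and fin: "trop_locally_finite W \<Sigma> \<Psi>"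
  shows "locally_finite_in (trop_toric W \<Sigma>) ((`) trop_incl ` \<Psi>)"
  unfolding locally_finite_in_def topspace_trop_toric[OF W \<Sigma>(1)]
proof (intro conjI ballI)
  have "{0} \<in> \<Sigma>"
    using \<Sigma>(1) fan_zero[OF \<Sigma>(1)] fan_face[OF \<Sigma>(1)] by (fastforce simp: fan_def)
  moreover have inc: "trop_incl w = ({0}, coset (span {0}) w)" for w :: 'a
    by (simp add: trop_incl_def coset_def)
  ultimately show "\<Union> ((`) trop_incl ` \<Psi>) \<subseteq> strata W \<Sigma>"
    using \<Psi> unfolding strata_def by fastforce
  fix p assume "p \<in> strata W \<Sigma>"
  then obtain \<tau> w where p: "p = (\<tau>, coset (span \<tau>) w)" "\<tau> \<in> \<Sigma>" "w \<in> W"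
    unfolding strata_def by blast
  obtain I where I: "finite I"
    "\<And>u c. (u, c) \<in> I \<Longrightarrow> (\<forall>x\<in>\<tau>. 0 \<le> u \<bullet> x) \<and> ((\<forall>x\<in>\<tau>. u \<bullet> x = 0) \<longrightarrow> c < u \<bullet> w)"
    "finite {P\<in>\<Psi>. \<exists>y\<in>P. \<forall>(u, c)\<in>I. c < u \<bullet> y}"
    using fin p(2,3) unfolding trop_locally_finite_def by fast
  note c\<tau> = fan_cone[OF \<Sigma>(1) p(2)]
  \<comment> \<open>Including the chart gives a nonempty family of open sets even when
    \<open>I\<close> is empty.\<close>
  define V where "V = affine_strata W \<tau> \<inter> (\<Inter>(u, c)\<in>I. trop_halfspace W \<tau> u c)"
  have "openin (trop_toric W \<Sigma>) (\<Inter>(insert (affine_strata W \<tau>) ((\<lambda>(u, c). trop_halfspace W \<tau> u c) ` I)))"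
    using I(1,2) openin_trop_chart[OF W \<Sigma> p(2)] openin_trop_halfspace[OF W \<Sigma> p(2)]
    by (intro openin_Inter) auto
  then have "openin (trop_toric W \<Sigma>) V" by (simp add: V_def)
  moreover have "p \<in> V"
  proof -
    have "\<tau> face_of \<tau>" using c\<tau>(1) by (simp add: face_of_refl polyhedron_imp_convex)
    then show ?thesis
      using p(3) I(2) c\<tau>(2)
      by (auto simp: V_def p(1) mem_trop_halfspace[OF p(3)] affine_strata_def strata_def)
  qed
  moreover have "finite {U \<in> (`) trop_incl ` \<Psi>. U \<inter> V \<noteq> {}}"
  proof (rule finite_subset[OF _ finite_imageI[OF I(3), of "(`) trop_incl"]], rule subsetI)
    fix U assume "U \<in> {U \<in> (`) trop_incl ` \<Psi>. U \<inter> V \<noteq> {}}"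
    then obtain P y where P: "P \<in> \<Psi>" "U = trop_incl ` P" "y \<in> P" "trop_incl y \<in> V" by blast
    have "y \<in> W" using P \<Psi> by blast
    then have "c < u \<bullet> y" if "(u, c) \<in> I" for u c
    proof -
      have "({0}, coset (span {0}) y) \<in> trop_halfspace W \<tau> u c"
        using P(4) that unfolding V_def inc by blast
      then show ?thesis unfolding mem_trop_halfspace[OF \<open>y \<in> W\<close>] by simp
    qed
    then show "U \<in> (`) trop_incl ` {P \<in> \<Psi>. \<exists>y\<in>P. \<forall>(u, c)\<in>I. c < u \<bullet> y}"
      using P by blast
  qed
  ultimately show "\<exists>V. openin (trop_toric W \<Sigma>) V \<and> p \<in> V \<and>
      finite {U \<in> (`) trop_incl ` \<Psi>. U \<inter> V \<noteq> {}}" by blast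
qed

section \<open>Faces of Minkowski sums\<close>

definition minkowski :: "'a::real_vector set \<Rightarrow> 'a set \<Rightarrow> 'a set" where
  "minkowski A B = {x + y |x y. x \<in> A \<and> y \<in> B}"

lemma mem_minkowskiI: "x \<in> A \<Longrightarrow> y \<in> B \<Longrightarrow> x + y \<in> minkowski A B"
  unfolding minkowski_def by blast

lemma mem_minkowskiE:
  assumes "z \<in> minkowski A B"
  obtains x y where "z = x + y" "x \<in> A" "y \<in> B"
  using assms unfolding minkowski_def by blast

lemma minkowski_zero: "minkowski A {0} = A"
  by (simp add: minkowski_def)

lemma minkowski_commute: "minkowski A B = minkowski B A"
  unfolding minkowski_def by (metis add.commute)

text \<open>Translation by \<open>b\<close> carries open segments of \<open>A\<close> to open
  segments of the sum, so the face property of \<open>K\<close> restricts to the slice.\<close>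

lemma face_of_minkowski_slice:
  fixes A B :: "'a::real_vector set"
  assumes K: "K face_of minkowski A B" and A: "convex A" and b: "b \<in> B"
  shows "{x\<in>A. x + b \<in> K} face_of A"
  unfolding face_of_def
proof (intro conjI ballI impI)
  have "{x. x + b \<in> K} = (\<lambda>x. x - b) ` K"
    by (auto simp: image_iff algebra_simps intro!: bexI[of _ "_ + b"])
  then have "convex {x. x + b \<in> K}"
    using face_of_imp_convex[OF K] convex_translation_subtract[of K b] by simp
  moreover have "{x\<in>A. x + b \<in> K} = A \<inter> {x. x + b \<in> K}" by blast
  ultimately show "convex {x\<in>A. x + b \<in> K}" using A by (simp add: convex_Int)
next
  fix x y z assume xy: "x \<in> A" "y \<in> A" and z: "z \<in> {x\<in>A. x + b \<in> K}" "z \<in> open_segment x y"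
  obtain t where t: "x \<noteq> y" "0 < t" "t < 1" "z = (1 - t) *\<^sub>R x + t *\<^sub>R y"
    using z(2) by (auto simp: in_segment)
  have "z + b = (1 - t) *\<^sub>R (x + b) + t *\<^sub>R (y + b)" by (simp add: t(4) algebra_simps)
  then have "z + b \<in> open_segment (x + b) (y + b)" using t(1-3) by (auto simp: in_segment)
  then have "x + b \<in> K \<and> y + b \<in> K"
    using face_ofD[OF K] mem_minkowskiI[OF _ b] xy z(1) by blast
  then show "x \<in> {x\<in>A. x + b \<in> K}" "y \<in> {x\<in>A. x + b \<in> K}" using xy by auto
qed auto

text \<open>Fix one point \<open>a + b\<close> of \<open>K\<close>. The summands of \<open>K\<close>
  are its slices through this point, and exchanging summands between points of \<open>K\<close>
  shows that they generate exactly \<open>K\<close>.\<close>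

lemma face_of_minkowskiE:
  fixes A B :: "'a::real_vector set"
  assumes K: "K face_of minkowski A B" "K \<noteq> {}" and A: "convex A" and B: "convex B"
  obtains A' B' where "K = minkowski A' B'" "A' face_of A" "A' \<noteq> {}" "B' face_of B" "B' \<noteq> {}"
proof -
  \<comment> \<open>The pairs \<open>x + y\<close>, \<open>x' + y'\<close> and
    \<open>x + y'\<close>, \<open>x' + y\<close> have the same midpoint; since \<open>K\<close> is a
    face, it contains the second pair along with the first.\<close>
  have swap: "x + y' \<in> K"
    if "x + y \<in> K" "x' + y' \<in> K" and in_AB: "x \<in> A" "x' \<in> A" "y \<in> B" "y' \<in> B" for x x' y y'
  proof -
    have "midpoint (x + y) (x' + y') \<in> K"
      using closed_segment_subset[OF that(1,2) face_of_imp_convex[OF K(1)]] by auto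
    then have m: "midpoint (x + y') (x' + y) \<in> K" by (simp add: midpoint_def algebra_simps)
    show ?thesis
    proof (cases "x + y' = x' + y")
      case True then show ?thesis using m by simp
    next
      case False
      then have "midpoint (x + y') (x' + y) \<in> open_segment (x + y') (x' + y)" by simp
      then show ?thesis using face_ofD[OF K(1) _ _ _ m] mem_minkowskiI in_AB by blast
    qed
  qed
  obtain a b where ab: "a \<in> A" "b \<in> B" "a + b \<in> K"
    using K face_of_imp_subset[OF K(1)] by (metis all_not_in_conv mem_minkowskiE subsetD)
  show thesis
  proof (rule that)
    show "{x\<in>A. x + b \<in> K} face_of A" by (rule face_of_minkowski_slice[OF K(1) A ab(2)])
    show "{y\<in>B. y + a \<in> K} face_of B"
      using K(1) unfolding minkowski_commute[of A] by (rule face_of_minkowski_slice[OF _ B ab(1)])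
    show "{x\<in>A. x + b \<in> K} \<noteq> {}" "{y\<in>B. y + a \<in> K} \<noteq> {}" using ab by (auto simp: add.commute)
    show "K = minkowski {x\<in>A. x + b \<in> K} {y\<in>B. y + a \<in> K}"
    proof (intro subset_antisym subsetI)
      fix z assume z: "z \<in> K"
      then obtain x y where xy: "z = x + y" "x \<in> A" "y \<in> B"
        using face_of_imp_subset[OF K(1)] by (blast elim: mem_minkowskiE)
      have "x + b \<in> K" using swap[of x y a b] xy ab z by simp
      moreover have "y + a \<in> K" using swap[of a b x y] xy ab z by (simp add: add.commute)
      ultimately show "z \<in> minkowski {x\<in>A. x + b \<in> K} {y\<in>B. y + a \<in> K}"
        unfolding xy(1) using xy by (intro mem_minkowskiI) auto
    next
      fix z assume "z \<in> minkowski {x\<in>A. x + b \<in> K} {y\<in>B. y + a \<in> K}"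
      then obtain x y where xy: "z = x + y" "x \<in> A" "y \<in> B" "x + b \<in> K" "y + a \<in> K"
        by (auto elim: mem_minkowskiE)
      then show "z \<in> K" using swap[of x b a y] ab by (simp add: add.commute)
    qed
  qed
qed

text \<open>In a direct sum the decomposition commutes with convex combinations, so the face
  property can be checked in each summand, as for a product of faces.\<close>

lemma face_of_minkowski_direct:
  fixes A B :: "'a::real_vector set"
  assumes A': "A' face_of A" and B': "B' face_of B" and AB: "convex A" "convex B"
    and direct: "\<And>x x' y y'. x \<in> A \<Longrightarrow> x' \<in> A \<Longrightarrow> y \<in> B \<Longrightarrow> y' \<in> B \<Longrightarrow>
      x + y = x' + y' \<Longrightarrow> x = x' \<and> y = y'"
  shows "minkowski A' B' face_of minkowski A B"
  unfolding face_of_def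
proof (intro conjI ballI impI)
  have sub: "A' \<subseteq> A" "B' \<subseteq> B" using A' B' by (auto dest: face_of_imp_subset)
  show "minkowski A' B' \<subseteq> minkowski A B" using sub unfolding minkowski_def by blast
  have "minkowski A' B' = (\<Union>x\<in>A'. \<Union>y\<in>B'. {x + y})" unfolding minkowski_def by blast
  then show "convex (minkowski A' B')"
    using convex_sums[OF face_of_imp_convex[OF A'] face_of_imp_convex[OF B']] by simp
  \<comment> \<open>The case \<open>x = y\<close> is included because a nondegenerate segment of the
    sum can have a constant component in one summand.\<close>
  have end_points: "x \<in> X' \<and> y \<in> X'"
    if X: "X' face_of X" "x \<in> X" "y \<in> X" and t: "0 < t" "t < 1" "(1 - t) *\<^sub>R x + t *\<^sub>R y \<in> X'"
    for x y :: 'a and X X' t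
  proof (cases "x = y")
    case True then show ?thesis using t(3) by (simp add: algebra_simps)
  next
    case False
    then have "(1 - t) *\<^sub>R x + t *\<^sub>R y \<in> open_segment x y" using t by (auto simp: in_segment)
    then show ?thesis using face_ofD[OF X(1) _ X(2,3) t(3)] by blast
  qed
  fix p q z assume pq: "p \<in> minkowski A B" "q \<in> minkowski A B"
    and z: "z \<in> minkowski A' B'" "z \<in> open_segment p q"
  obtain x1 y1 where 1: "p = x1 + y1" "x1 \<in> A" "y1 \<in> B" using pq(1) by (rule mem_minkowskiE)
  obtain x2 y2 where 2: "q = x2 + y2" "x2 \<in> A" "y2 \<in> B" using pq(2) by (rule mem_minkowskiE)
  obtain x y where 3: "z = x + y" "x \<in> A'" "y \<in> B'" using z(1) by (rule mem_minkowskiE)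
  obtain t where t: "0 < t" "t < 1" "z = (1 - t) *\<^sub>R p + t *\<^sub>R q" using z(2) by (auto simp: in_segment)
  have "x = (1 - t) *\<^sub>R x1 + t *\<^sub>R x2 \<and> y = (1 - t) *\<^sub>R y1 + t *\<^sub>R y2"
  proof (rule direct)
    show "x \<in> A" "y \<in> B" using 3 sub by auto
    show "(1 - t) *\<^sub>R x1 + t *\<^sub>R x2 \<in> A" using convexD_alt[OF AB(1) 1(2) 2(2)] t by simp
    show "(1 - t) *\<^sub>R y1 + t *\<^sub>R y2 \<in> B" using convexD_alt[OF AB(2) 1(3) 2(3)] t by simp
    show "x + y = (1 - t) *\<^sub>R x1 + t *\<^sub>R x2 + ((1 - t) *\<^sub>R y1 + t *\<^sub>R y2)"
      using t(3) unfolding 1(1) 2(1) 3(1) by (simp add: algebra_simps)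
  qed
  then have "x1 \<in> A' \<and> x2 \<in> A'" "y1 \<in> B' \<and> y2 \<in> B'"
    using end_points[OF A' 1(2) 2(2) t(1,2)] end_points[OF B' 1(3) 2(3) t(1,2)] 3 by auto
  then show "p \<in> minkowski A' B'" "q \<in> minkowski A' B'"
    unfolding 1(1) 2(1) by (blast intro: mem_minkowskiI)+
qed

section \<open>Compact sets meeting locally finite families, and minimal faces\<close>

lemma locally_finite_in_compactin:
  assumes "locally_finite_in X \<A>" and K: "compactin X K"
  shows "finite {U\<in>\<A>. U \<inter> K \<noteq> {}}"
proof -
  have "K \<subseteq> topspace X" using K by (rule compactin_subset_topspace)
  then have "\<forall>x\<in>K. \<exists>V. openin X V \<and> x \<in> V \<and> finite {U\<in>\<A>. U \<inter> V \<noteq> {}}"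
    using assms(1) unfolding locally_finite_in_def by blast
  then obtain V where V: "\<And>x. x \<in> K \<Longrightarrow> openin X (V x) \<and> x \<in> V x \<and> finite {U\<in>\<A>. U \<inter> V x \<noteq> {}}"
    by metis
  then obtain \<F> where \<F>: "finite \<F>" "\<F> \<subseteq> V ` K" "K \<subseteq> \<Union>\<F>"
    using compactinD[OF K, of "V ` K"] by blast
  have "{U\<in>\<A>. U \<inter> K \<noteq> {}} \<subseteq> (\<Union>B\<in>\<F>. {U\<in>\<A>. U \<inter> B \<noteq> {}})" using \<F>(3) by blast
  moreover have "finite (\<Union>B\<in>\<F>. {U\<in>\<A>. U \<inter> B \<noteq> {}})" using \<F>(1,2) V by blast
  ultimately show ?thesis by (rule finite_subset)
qed

text \<open>Take a minimal face containing \<open>y\<close>: if \<open>y\<close> were on its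
  relative boundary, some facet of it would be a smaller choice.\<close>

lemma polyhedron_minimal_face:
  fixes P :: "'a::euclidean_space set"
  assumes P: "polyhedron P" and y: "y \<in> P"
  obtains F where "F face_of P" "y \<in> rel_interior F"
proof -
  define \<A> where "\<A> = {F. F face_of P \<and> y \<in> F}"
  have "finite \<A>"
    by (rule finite_subset[OF _ finite_polyhedron_faces[OF P]]) (auto simp: \<A>_def)
  moreover have "P \<in> \<A>"
    using y P by (simp add: \<A>_def face_of_refl polyhedron_imp_convex)
  ultimately obtain F where F: "F \<in> \<A>" "\<And>G. G \<in> \<A> \<Longrightarrow> G \<subseteq> F \<Longrightarrow> G = F"
    using finite_has_minimal[of \<A>] by blast
  have FP: "F face_of P" "y \<in> F" using F(1) by (auto simp: \<A>_def)
  have "y \<in> rel_interior F"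
  proof (rule ccontr)
    assume "y \<notin> rel_interior F"
    then have "y \<in> F - rel_interior F" using FP(2) by blast
    then obtain G where G: "G facet_of F" "y \<in> G"
      using rel_boundary_of_polyhedron[OF face_of_polyhedron_polyhedron[OF P FP(1)]] by blast
    then have "G \<in> \<A>" "G \<subseteq> F"
      using face_of_trans[OF facet_of_imp_face_of[OF G(1)] FP(1)] facet_of_imp_subset[OF G(1)]
      by (auto simp: \<A>_def)
    then have "G = F" by (rule F(2))
    then show False using G(1) by (simp add: facet_of_irrefl)
  qed
  then show thesis using FP(1) that by blast
qed

section \<open>Removing a maximal cone from the recession fan\<close>

text \<open>The complex \<open>\<Psi>\<close> is allowed to be infinite, since the construction is
  iterated and each pass may create infinitely many cells.\<close>

locale ray_refinement =
  fixes \<Psi> \<Sigma> S :: "'a::euclidean_space set set" and \<sigma> :: "'a set" and v :: 'a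
  assumes \<Psi>: "polyhedral_complex \<Psi>" and \<Sigma>: "fan \<Sigma>" and rec: "rec_cone ` \<Psi> \<subseteq> \<Sigma>"
    and \<sigma>: "\<sigma> \<in> \<Sigma>" and maximal: "\<And>\<tau>. \<tau> \<in> \<Sigma> \<Longrightarrow> \<sigma> face_of \<tau> \<Longrightarrow> \<tau> = \<sigma>"
    and v: "v \<in> rel_interior \<sigma>" "v \<noteq> 0"
    and S: "polyhedral_complex S" "\<And>s. s \<in> S \<Longrightarrow> polytope s" "\<Union>S = {t *\<^sub>R v |t. t \<ge> 0}"
    and lfS: "locally_finite_in (top_of_set {t *\<^sub>R v |t. t \<ge> 0}) S"
begin

text \<open>
  The cells in the lower boundary, as seen along \<open>v\<close>, of the region to be subdivided: every point of
  that region is uniquely \<open>y + t v\<close> with \<open>t \<ge> 0\<close> and \<open>y\<close> in such a cell.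
\<close>

definition low :: "'a set set" where
  "low = {F\<in>\<Psi>. rec_cone F \<noteq> \<sigma> \<and> (\<exists>P\<in>\<Psi>. rec_cone P = \<sigma> \<and> F face_of P)}"

definition refined :: "'a set set" where
  "refined = {P\<in>\<Psi>. rec_cone P \<noteq> \<sigma>} \<union> {minkowski F s |F s. F \<in> low \<and> s \<in> S}"

section \<open>Decomposition along the chosen ray\<close>

lemma complex_convex:
  assumes "P \<in> \<Psi>"
  shows "polyhedron P" "closed P" "convex P" "P \<noteq> {}"
  using polyhedral_complexD(1,2)[OF \<Psi> assms] polyhedron_imp_closed polyhedron_imp_convex by auto

lemma v_in: "v \<in> \<sigma>"
  using v(1) rel_interior_subset by blast

text \<open>If \<open>rec_cone P\<close> contains the relatively interior point \<open>v\<close> of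
  \<sigma>, then the face \<open>\<sigma> \<inter> rec_cone P\<close> of \<sigma> is all of
  \<sigma>, and maximality applies. Thus recession cones are compared with \<sigma> by testing a
  single vector.\<close>

lemma rec_eq_iff:
  assumes P: "P \<in> \<Psi>"
  shows "rec_cone P = \<sigma> \<longleftrightarrow> v \<in> rec_cone P"
proof
  assume vP: "v \<in> rec_cone P"
  have R: "rec_cone P \<in> \<Sigma>" using rec P by blast
  note f = fan_Int_face[OF \<Sigma> \<sigma> R]
  have "\<sigma> \<subseteq> \<sigma> \<inter> rec_cone P"
    by (rule subset_of_face_of[OF f(1)]) (use v(1) vP v_in in auto)
  then have "\<sigma> \<inter> rec_cone P = \<sigma>" by blast
  then have "\<sigma> face_of rec_cone P" using f(2) by simp
  then show "rec_cone P = \<sigma>" by (rule maximal[OF R])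
qed (use v_in in simp)

lemma v_notin_sub:
  assumes "P \<in> \<Psi>" "rec_cone P \<noteq> \<sigma>" "F \<subseteq> P" "F \<noteq> {}"
  shows "v \<notin> rec_cone F"
  using rec_cone_mono[of P F] rec_eq_iff[OF assms(1)] complex_convex[OF assms(1)] assms by blast

lemma segment_coordinate:
  assumes "s \<in> S" "z \<in> s"
  obtains t where "0 \<le> t" "z = t *\<^sub>R v"
  using assms S(3) by blast

lemma along_v:
  assumes "P \<in> \<Psi>" "rec_cone P = \<sigma>" "x \<in> P" "0 \<le> t"
  shows "x + t *\<^sub>R v \<in> P"
  using rec_coneD[of v P x t] v_in assms by simp

text \<open>The ray from \<open>y\<close> along \<open>v\<close> stays in \<open>P\<close>, and the
  face \<open>P \<inter> G\<close> of \<open>P\<close> contains a point strictly inside it. The face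
  property then puts all later points of the ray into \<open>G\<close>.\<close>

lemma entered_in_direction_v:
  assumes P: "P \<in> \<Psi>" "rec_cone P = \<sigma>" "y \<in> P" and G: "G \<in> \<Psi>" "y + e *\<^sub>R v \<in> G" and e: "0 < e"
  shows "rec_cone G = \<sigma>"
proof -
  have f: "(P \<inter> G) face_of P" by (rule polyhedral_complexD(4)[OF \<Psi> P(1) G(1)])
  have "y + (e + r) *\<^sub>R v \<in> G" if r: "0 < r" for r
  proof -
    have in_P: "y + e *\<^sub>R v \<in> P" "y + (e + r) *\<^sub>R v \<in> P" using along_v[OF P] e r by simp_all
    have "(1 - k) *\<^sub>R y + k *\<^sub>R (y + l *\<^sub>R v) = y + (k * l) *\<^sub>R v" for k l
      by (simp add: algebra_simps)
    from this[of "e / (e + r)" "e + r"]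
    have "y + e *\<^sub>R v = (1 - e / (e + r)) *\<^sub>R y + (e / (e + r)) *\<^sub>R (y + (e + r) *\<^sub>R v)"
      using e r by simp
    moreover have "y \<noteq> y + (e + r) *\<^sub>R v" using v(2) e r by simp
    ultimately have "y + e *\<^sub>R v \<in> open_segment y (y + (e + r) *\<^sub>R v)"
      unfolding in_segment using e r by (intro conjI exI[of _ "e / (e + r)"]) auto
    then show ?thesis using face_ofD[OF f _ P(3) in_P(2)] in_P(1) G(2) by blast
  qed
  then have "\<exists>r\<ge>N. y + r *\<^sub>R v \<in> G" for N
    by (intro exI[of _ "e + max N 1"]) (use e in auto)
  then have "v \<in> rec_cone G" using complex_convex[OF G(1)] by (intro mem_rec_coneI_line) auto
  then show ?thesis using rec_eq_iff[OF G(1)] by simp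
qed

lemma lowE:
  assumes "F \<in> low"
  obtains P where "F \<in> \<Psi>" "rec_cone F \<noteq> \<sigma>" "P \<in> \<Psi>" "rec_cone P = \<sigma>" "F face_of P" "F \<subseteq> P"
  using assms face_of_imp_subset unfolding low_def by blast

text \<open>If \<open>a > b\<close>, then \<open>z\<close> is reached from \<open>y\<close> by
  moving forward along \<open>v\<close>, so \<open>entered_in_direction_v\<close> makes \<sigma> the
  recession cone of \<open>G\<close>, which is excluded for low cells. The two cells may bound
  different cells of the region.\<close>

lemma low_decomposition_unique:
  assumes F: "F \<in> low" "y \<in> F" "0 \<le> a" and G: "G \<in> low" "z \<in> G" "0 \<le> b"
    and eq: "y + a *\<^sub>R v = z + b *\<^sub>R v"
  shows "y = z \<and> a = b"
proof -
  have le: "a \<le> b" if F: "F \<in> low" "y \<in> F" and G: "G \<in> low" "z \<in> G"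
    and eq: "y + a *\<^sub>R v = z + b *\<^sub>R v" for F G y z a b
  proof (rule ccontr)
    assume "\<not> a \<le> b"
    then have ab: "0 < a - b" by simp
    obtain P where P: "P \<in> \<Psi>" "rec_cone P = \<sigma>" "F \<subseteq> P" using F(1) by (rule lowE)
    have G': "G \<in> \<Psi>" "rec_cone G \<noteq> \<sigma>" using G(1) by (auto simp: low_def)
    have "z = y + (a - b) *\<^sub>R v" using eq by (simp add: algebra_simps)
    then have "y + (a - b) *\<^sub>R v \<in> G" using G(2) by simp
    then show False using entered_in_direction_v[OF P(1,2) _ G'(1) _ ab, of y] P(3) F(2) G'(2) by blast
  qed
  have "a = b" using le[OF F(1,2) G(1,2) eq] le[OF G(1,2) F(1,2) eq[symmetric]] by simp
  then show ?thesis using eq by simp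
qed

lemma minkowski_unique:
  assumes "F \<in> low" "y \<in> F" "s \<in> S" "p \<in> s" and "G \<in> low" "z \<in> G" "t \<in> S" "q \<in> t"
    and eq: "y + p = z + q"
  shows "y = z \<and> p = q"
proof -
  obtain a where a: "0 \<le> a" "p = a *\<^sub>R v" using segment_coordinate[OF assms(3,4)] .
  obtain b where b: "0 \<le> b" "q = b *\<^sub>R v" using segment_coordinate[OF assms(7,8)] .
  show ?thesis
    using low_decomposition_unique[OF assms(1,2) a(1) assms(5,6) b(1)] eq a(2) b(2) by simp
qed

lemma S_convex:
  assumes "s \<in> S"
  shows "convex s" "s \<noteq> {}" "bounded s" "polyhedron s"
  using S(2)[OF assms] polyhedral_complexD(1,2)[OF S(1) assms]
  by (auto simp: polytope_imp_convex polytope_imp_bounded)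

text \<open>The origin is the endpoint of the ray, hence extreme in any cell containing it. This
  allows a low cell \<open>F\<close> to be treated as the new cell \<open>F + {0}\<close>.\<close>

lemma zero_in_S: "{0} \<in> S"
proof -
  have "0 \<in> \<Union>S" unfolding S(3) by force
  then obtain s where s: "s \<in> S" "0 \<in> s" by blast
  have "{0} face_of s"
    unfolding face_of_singleton extreme_point_of_def
  proof (intro conjI ballI notI)
    fix x y assume xy: "x \<in> s" "y \<in> s" "0 \<in> open_segment x y"
    obtain a where a: "0 \<le> a" "x = a *\<^sub>R v" using segment_coordinate[OF s(1) xy(1)] .
    obtain b where b: "0 \<le> b" "y = b *\<^sub>R v" using segment_coordinate[OF s(1) xy(2)] .
    obtain t where t: "x \<noteq> y" "0 < t" "t < 1" "0 = (1 - t) *\<^sub>R x + t *\<^sub>R y"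
      using xy(3) by (auto simp: in_segment)
    have "((1 - t) * a + t * b) *\<^sub>R v = 0" using t(4) by (simp add: a(2) b(2) scaleR_add_left)
    then have "(1 - t) * a + t * b = 0" using v(2) by simp
    moreover have "0 \<le> (1 - t) * a" "0 \<le> t * b" using t a(1) b(1) by simp_all
    ultimately have "(1 - t) * a = 0" "t * b = 0" by linarith+
    then show False using t(1-3) a(2) b(2) by simp
  qed (rule s(2))
  then show ?thesis using polyhedral_complexD(3)[OF S(1) s(1)] by simp
qed

lemma face_in_low:
  assumes "F \<in> low" "F' face_of F" "F' \<noteq> {}"
  shows "F' \<in> low"
proof -
  obtain P where P: "F \<in> \<Psi>" "rec_cone F \<noteq> \<sigma>" "P \<in> \<Psi>" "rec_cone P = \<sigma>" "F face_of P"
    using assms(1) by (rule lowE)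
  have F': "F' \<in> \<Psi>" by (rule polyhedral_complexD(3)[OF \<Psi> P(1) assms(2,3)])
  have "rec_cone F' \<noteq> \<sigma>"
    using v_notin_sub[OF P(1,2) face_of_imp_subset[OF assms(2)] assms(3)] rec_eq_iff[OF F'] by simp
  then show ?thesis
    using F' P(3,4) face_of_trans[OF assms(2) P(5)] unfolding low_def by blast
qed

text \<open>By unique decomposition the intersection is
  \<open>(F \<inter> G) + (s \<inter> t)\<close>, a direct sum of faces.\<close>

lemma new_cell_Int:
  assumes F: "F \<in> low" "s \<in> S" and G: "G \<in> low" "t \<in> S"
  shows "(minkowski F s \<inter> minkowski G t) face_of minkowski F s"
proof -
  have FG: "F \<in> \<Psi>" "G \<in> \<Psi>" using F(1) G(1) by (auto simp: low_def)
  have "minkowski F s \<inter> minkowski G t = minkowski (F \<inter> G) (s \<inter> t)"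
  proof (intro subset_antisym subsetI)
    fix x assume x: "x \<in> minkowski F s \<inter> minkowski G t"
    then obtain y p where yp: "x = y + p" "y \<in> F" "p \<in> s" by (blast elim: mem_minkowskiE)
    obtain z q where zq: "x = z + q" "z \<in> G" "q \<in> t" using x by (blast elim: mem_minkowskiE)
    have "y = z \<and> p = q"
      by (rule minkowski_unique[OF F(1) yp(2) F(2) yp(3) G(1) zq(2) G(2) zq(3)]) (use yp zq in simp)
    then show "x \<in> minkowski (F \<inter> G) (s \<inter> t)"
      unfolding yp(1) using yp zq by (intro mem_minkowskiI) auto
  qed (auto simp: minkowski_def)
  moreover have "minkowski (F \<inter> G) (s \<inter> t) face_of minkowski F s"
  proof (rule face_of_minkowski_direct)
    show "F \<inter> G face_of F" by (rule polyhedral_complexD(4)[OF \<Psi> FG])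
    show "s \<inter> t face_of s" by (rule polyhedral_complexD(4)[OF S(1) F(2) G(2)])
    show "convex F" "convex s" using complex_convex[OF FG(1)] S_convex[OF F(2)] by auto
  qed (rule minkowski_unique[OF F(1) _ F(2) _ F(1) _ F(2)])
  ultimately show ?thesis by simp
qed

lemma new_cell_subset:
  assumes "F \<in> low" "s \<in> S"
  obtains P where "P \<in> \<Psi>" "rec_cone P = \<sigma>" "F face_of P" "minkowski F s \<subseteq> P"
proof -
  obtain P where P: "P \<in> \<Psi>" "rec_cone P = \<sigma>" "F face_of P" "F \<subseteq> P"
    using assms(1) by (rule lowE)
  have "minkowski F s \<subseteq> P"
  proof
    fix x assume "x \<in> minkowski F s"
    then obtain y z where yz: "x = y + z" "y \<in> F" "z \<in> s" by (rule mem_minkowskiE)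
    obtain a where "0 \<le> a" "z = a *\<^sub>R v" using segment_coordinate[OF assms(2) yz(3)] .
    then show "x \<in> P" using along_v[OF P(1,2)] yz P(4) by auto
  qed
  then show thesis using P that by blast
qed

text \<open>The new cell lies in some \<open>Q\<close> with recession cone \<sigma>, so only
  \<open>P \<inter> Q\<close> matters. If nonempty, this is a low cell, hence the new cell
  \<open>(P \<inter> Q) + {0}\<close>, and the case of two new cells applies.\<close>

lemma old_new_Int:
  assumes P: "P \<in> \<Psi>" "rec_cone P \<noteq> \<sigma>" and G: "G \<in> low" "t \<in> S"
  shows "(P \<inter> minkowski G t) face_of P" "(P \<inter> minkowski G t) face_of minkowski G t"
proof -
  obtain Q where Q: "Q \<in> \<Psi>" "rec_cone Q = \<sigma>" "minkowski G t \<subseteq> Q"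
    using new_cell_subset[OF G] .
  have "(P \<inter> minkowski G t) face_of P \<and> (P \<inter> minkowski G t) face_of minkowski G t"
  proof (cases "P \<inter> Q = {}")
    case True
    then have "P \<inter> minkowski G t = {}" using Q(3) by blast
    then show ?thesis by simp
  next
    case False
    have f: "P \<inter> Q face_of P" "P \<inter> Q face_of Q"
      using polyhedral_complexD(4,5)[OF \<Psi> P(1) Q(1)] by auto
    have E: "P \<inter> Q \<in> \<Psi>" by (rule polyhedral_complexD(3)[OF \<Psi> P(1) f(1) False])
    have "rec_cone (P \<inter> Q) \<noteq> \<sigma>"
      using v_notin_sub[OF P, of "P \<inter> Q"] False rec_eq_iff[OF E] by blast
    then have low: "P \<inter> Q \<in> low" using E Q(1,2) f(2) unfolding low_def by blast
    have "P \<inter> minkowski G t = minkowski (P \<inter> Q) {0} \<inter> minkowski G t"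
      unfolding minkowski_zero using Q(3) by blast
    moreover have "minkowski (P \<inter> Q) {0} \<inter> minkowski G t face_of P"
      using face_of_trans[OF new_cell_Int[OF low zero_in_S G, unfolded minkowski_zero] f(1)]
      by (simp add: minkowski_zero)
    moreover have "minkowski (P \<inter> Q) {0} \<inter> minkowski G t face_of minkowski G t"
      using new_cell_Int[OF G low zero_in_S] by (simp add: Int_commute)
    ultimately show ?thesis by simp
  qed
  then show "(P \<inter> minkowski G t) face_of P" "(P \<inter> minkowski G t) face_of minkowski G t" by auto
qed

lemma refined_cases:
  assumes "P \<in> refined"
  obtains (old) "P \<in> \<Psi>" "rec_cone P \<noteq> \<sigma>"
    | (new) F s where "P = minkowski F s" "F \<in> low" "s \<in> S"
  using assms unfolding refined_def by blast

text \<open>Faces of a sum are sums of faces, and both families are closed under nonempty faces. The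
  hypothesis \<open>poly\<close> is later supplied by closure of the class under Minkowski
  sums.\<close>

lemma polyhedral_complex_refined:
  assumes poly: "\<And>F s. F \<in> low \<Longrightarrow> s \<in> S \<Longrightarrow> polyhedron (minkowski F s)"
  shows "polyhedral_complex refined"
  unfolding polyhedral_complex_def
proof (intro conjI ballI allI impI; (elim conjE)?)
  fix P assume P: "P \<in> refined"
  then show "polyhedron P"
    by (cases rule: refined_cases) (use poly complex_convex in auto)
  show "P \<noteq> {}" using P
  proof (cases rule: refined_cases)
    case (new F s)
    then have "F \<noteq> {}" "s \<noteq> {}" using complex_convex S_convex by (auto simp: low_def)
    then show ?thesis unfolding new(1) by (metis ex_in_conv mem_minkowskiI)
  qed (use complex_convex in blast)
  show "K \<in> refined" if K: "K face_of P" "K \<noteq> {}" for K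
    using P
  proof (cases rule: refined_cases)
    case old
    have K': "K \<in> \<Psi>" by (rule polyhedral_complexD(3)[OF \<Psi> old(1) K])
    have "rec_cone K \<noteq> \<sigma>"
      using v_notin_sub[OF old face_of_imp_subset[OF K(1)] K(2)] rec_eq_iff[OF K'] by simp
    then show ?thesis using K' by (simp add: refined_def)
  next
    case (new F s)
    have "convex F" "convex s" using complex_convex S_convex new by (auto simp: low_def)
    then obtain F' s' where K': "K = minkowski F' s'" "F' face_of F" "F' \<noteq> {}" "s' face_of s" "s' \<noteq> {}"
      using face_of_minkowskiE[OF K(1)[unfolded new(1)] K(2)] by metis
    have "F' \<in> low" by (rule face_in_low[OF new(2) K'(2,3)])
    moreover have "s' \<in> S" by (rule polyhedral_complexD(3)[OF S(1) new(3) K'(4,5)])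
    ultimately show ?thesis unfolding refined_def K'(1) by blast
  qed
  fix Q assume Q: "Q \<in> refined"
  have "(P \<inter> Q) face_of P \<and> (P \<inter> Q) face_of Q"
    using P
  proof (cases rule: refined_cases)
    case P': old
    show ?thesis using Q
    proof (cases rule: refined_cases)
      case old
      then show ?thesis using polyhedral_complexD(4,5)[OF \<Psi> P'(1) old(1)] by blast
    next
      case (new G t)
      then show ?thesis using old_new_Int[OF P' new(2,3)] by simp
    qed
  next
    case P': (new F s)
    show ?thesis using Q
    proof (cases rule: refined_cases)
      case old
      then show ?thesis using old_new_Int[OF old P'(2,3)] P'(1) by (simp add: Int_commute)
    next
      case (new G t)
      then show ?thesis
        using new_cell_Int[OF P'(2,3) new(2,3)] new_cell_Int[OF new(2,3) P'(2,3)] P'(1)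
        by (simp add: Int_commute)
    qed
  qed
  then show "(P \<inter> Q) face_of P" "(P \<inter> Q) face_of Q" by auto
qed

text \<open>To cover a point of a cell with recession cone \<sigma>, go back along \<open>v\<close>
  until just before leaving the cell; the minimal face at the last point is low.\<close>

lemma Union_refined: "\<Union>refined = \<Union>\<Psi>"
proof (intro subset_antisym subsetI)
  fix x assume "x \<in> \<Union>refined"
  then show "x \<in> \<Union>\<Psi>"
    by (auto elim!: refined_cases) (meson new_cell_subset subsetD)
next
  fix x assume "x \<in> \<Union>\<Psi>"
  then obtain P where P: "P \<in> \<Psi>" "x \<in> P" by blast
  show "x \<in> \<Union>refined"
  proof (cases "rec_cone P = \<sigma>")
    case False
    then have "P \<in> refined" using P(1) by (simp add: refined_def)
    then show ?thesis using P(2) by blast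
  next
    case True
    note cP = complex_convex[OF P(1)]
    \<comment> \<open>Pointedness of \<sigma> excludes \<open>-v\<close> as a recession direction,
      so the backward line leaves \<open>P\<close> for good and \<open>T\<close> is compact.\<close>
    define T where "T = {t::real. 0 \<le> t \<and> x - t *\<^sub>R v \<in> P}"
    have "- v \<notin> rec_cone P" using fan_cone(5)[OF \<Sigma> \<sigma>, of v] v_in v(2) True by blast
    then have "\<not> (\<forall>N. \<exists>r\<ge>N. x + r *\<^sub>R (- v) \<in> P)" using mem_rec_coneI_line[OF cP(2,3)] by blast
    then obtain N where N: "\<And>r. N \<le> r \<Longrightarrow> x - r *\<^sub>R v \<notin> P" by auto
    have "t \<le> N" if "t \<in> T" for t
      using N[of t] that unfolding T_def by (cases "N \<le> t") auto
    then have "T = {0..N} \<inter> (\<lambda>t. x - t *\<^sub>R v) -` P" by (auto simp: T_def)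
    moreover have "compact ({0..N} \<inter> (\<lambda>t. x - t *\<^sub>R v) -` P)"
      by (intro compact_Int_closed closed_vimage cP(2) continuous_intros) auto
    ultimately have "compact T" by simp
    moreover have "0 \<in> T" using P(2) by (simp add: T_def)
    ultimately obtain a where a: "a \<in> T" "\<And>t. t \<in> T \<Longrightarrow> t \<le> a"
      using compact_attains_sup[of T] by blast
    define y where "y = x - a *\<^sub>R v"
    have y: "y \<in> P" "0 \<le> a" using a(1) by (auto simp: T_def y_def)
    obtain F where F: "F face_of P" "y \<in> rel_interior F" using polyhedron_minimal_face[OF cP(1) y(1)] .
    have yF: "y \<in> F" using F(2) rel_interior_subset by blast
    have F\<Psi>: "F \<in> \<Psi>" by (rule polyhedral_complexD(3)[OF \<Psi> P(1) F(1)]) (use yF in blast)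
    \<comment> \<open>Otherwise \<open>y + v\<close> lies in \<open>F\<close>, and since
      \<open>y\<close> is relatively interior, \<open>F\<close> extends beyond \<open>y\<close> in
      the direction \<open>-v\<close>, against the maximality of \<open>a\<close>.\<close>
    have "v \<notin> rec_cone F"
    proof
      assume "v \<in> rec_cone F"
      then have "y + v \<in> F" using rec_coneD[of v F y 1] yF by simp
      then obtain e where e: "1 < e" "(1 - e) *\<^sub>R (y + v) + e *\<^sub>R y \<in> F"
        using convex_rel_interior_iff[OF complex_convex(3,4)[OF F\<Psi>], of y] F(2) by blast
      have "(1 - e) *\<^sub>R (y + v) + e *\<^sub>R y = x - (a + (e - 1)) *\<^sub>R v"
        by (simp add: y_def algebra_simps)
      then have "a + (e - 1) \<in> T"
        using e face_of_imp_subset[OF F(1)] y(2) by (auto simp: T_def)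
      then show False using a(2) e(1) by fastforce
    qed
    then have low: "F \<in> low" using F\<Psi> P(1) True F(1) rec_eq_iff[OF F\<Psi>] unfolding low_def by blast
    have "a *\<^sub>R v \<in> \<Union>S" unfolding S(3) using y(2) by blast
    then obtain s where s: "s \<in> S" "a *\<^sub>R v \<in> s" by blast
    have "x \<in> minkowski F s"
      using mem_minkowskiI[OF yF s(2)] by (simp add: y_def)
    moreover have "minkowski F s \<in> refined" using low s(1) unfolding refined_def by blast
    ultimately show ?thesis by blast
  qed
qed

section \<open>Recession cones and local finiteness of the refined complex\<close>

lemma rec_cone_new_cell:
  assumes "F \<in> low" "s \<in> S"
  shows "rec_cone (minkowski F s) = rec_cone F"
  unfolding minkowski_def
  by (rule rec_cone_add_bounded) (use assms complex_convex S_convex in \<open>auto simp: low_def\<close>)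

lemma rec_cone_refined: "rec_cone ` refined \<subseteq> \<Sigma> - {\<sigma>}"
proof
  fix \<tau> assume "\<tau> \<in> rec_cone ` refined"
  then obtain P where P: "P \<in> refined" "\<tau> = rec_cone P" by blast
  from P(1) have "\<exists>F\<in>\<Psi>. rec_cone F \<noteq> \<sigma> \<and> rec_cone P = rec_cone F"
  proof (cases rule: refined_cases)
    case (new F s)
    then have "rec_cone P = rec_cone F" using rec_cone_new_cell by simp
    then show ?thesis using new(2) by (auto simp: low_def)
  qed blast
  then show "\<tau> \<in> \<Sigma> - {\<sigma>}" using rec unfolding P(2) by auto
qed

lemma finite_segments_upto: "finite {s\<in>S. \<exists>t. 0 \<le> t \<and> t \<le> L \<and> t *\<^sub>R v \<in> s}"
proof -
  have "compactin (top_of_set {t *\<^sub>R v |t. t \<ge> 0}) ((\<lambda>t. t *\<^sub>R v) ` {0..L})"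
    unfolding compactin_subtopology compactin_euclidean_iff
    by (auto intro!: compact_continuous_image continuous_intros)
  from locally_finite_in_compactin[OF lfS this]
  show ?thesis by (rule rev_finite_subset) fastforce
qed

text \<open>A form \<open>e\<close> exposing \<open>\<sigma> \<inter> \<tau>\<close> in \<tau>
  splits into polar forms \<open>u\<close> of \<sigma> and \<open>w\<close> of \<tau>. If
  \<open>u\<close> vanished on \<tau>, then \<open>e = w\<close> there would be both nonnegative and
  nonpositive, making \<tau> a face of \<sigma>.\<close>

lemma separating_coordinate:
  assumes \<tau>: "\<tau> \<in> \<Sigma>" "\<not> \<tau> face_of \<sigma>"
  obtains u where "\<And>x. x \<in> \<tau> \<Longrightarrow> 0 \<le> u \<bullet> x" "\<exists>x\<in>\<tau>. u \<bullet> x \<noteq> 0" "\<And>x. x \<in> \<sigma> \<Longrightarrow> u \<bullet> x \<le> 0"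
proof -
  note c\<sigma> = fan_cone[OF \<Sigma> \<sigma>] and c\<tau> = fan_cone[OF \<Sigma> \<tau>(1)]
  have ne: "\<sigma> \<inter> \<tau> \<noteq> {}" using c\<sigma>(4) c\<tau>(4) by blast
  obtain e where e: "\<And>x. x \<in> \<tau> \<Longrightarrow> 0 \<le> e \<bullet> x" "\<sigma> \<inter> \<tau> = {x\<in>\<tau>. e \<bullet> x = 0}"
    using polyhedral_cone_face_exposed[OF c\<tau>(1,3) fan_Int_face(2)[OF \<Sigma> \<sigma> \<tau>(1)] ne] by blast
  have "e \<bullet> x \<le> 0" if "x \<in> \<sigma> \<inter> \<tau>" for x using that unfolding e(2) by simp
  then obtain u w where uw: "e = u + w" "\<And>x. x \<in> \<sigma> \<Longrightarrow> u \<bullet> x \<le> 0" "\<And>x. x \<in> \<tau> \<Longrightarrow> w \<bullet> x \<le> 0"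
    using polar_Int_polyhedral_cones[OF c\<sigma>(1,3,2) c\<tau>(1,3,2), of e] by blast
  show thesis
  proof (rule that)
    show "0 \<le> u \<bullet> x" if "x \<in> \<tau>" for x
      using e(1)[OF that] uw(3)[OF that] by (simp add: uw(1) inner_add_left)
    show "\<exists>x\<in>\<tau>. u \<bullet> x \<noteq> 0"
    proof (rule ccontr)
      assume "\<not> (\<exists>x\<in>\<tau>. u \<bullet> x \<noteq> 0)"
      then have "e \<bullet> x = 0" if "x \<in> \<tau>" for x
        using e(1)[OF that] uw(3)[OF that] that by (simp add: uw(1) inner_add_left)
      then have "\<sigma> \<inter> \<tau> = \<tau>" unfolding e(2) by blast
      then show False using fan_Int_face(1)[OF \<Sigma> \<sigma> \<tau>(1)] \<tau>(2) by simp
    qed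
  qed (rule uw(2))
qed

text \<open>A new cell meeting the old neighbourhood lies in a cell of \<open>\<Psi>\<close> meeting
  it, and there are finitely many of those. So one further coordinate \<open>i\<close> is enough if
  it bounds the position along \<open>v\<close>, or avoids these cells altogether.\<close>

lemma trop_locally_finite_refined:
  assumes lf: "trop_locally_finite W \<Sigma> \<Psi>"
  shows "trop_locally_finite W (\<Sigma> - {\<sigma>}) refined"
  unfolding trop_locally_finite_def
proof (intro ballI)
  fix \<tau> w assume \<tau>: "\<tau> \<in> \<Sigma> - {\<sigma>}" and w: "w \<in> W"
  define good where "good = (\<lambda>(u, c). (\<forall>x\<in>\<tau>. 0 \<le> u \<bullet> x) \<and> ((\<forall>x\<in>\<tau>. u \<bullet> x = 0) \<longrightarrow> c < u \<bullet> w))"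
  define meets where "meets I P \<longleftrightarrow> (\<exists>y\<in>P. \<forall>(u, c)\<in>I. c < u \<bullet> y)" for I :: "('a \<times> real) set" and P
  have "\<exists>I. finite I \<and> (\<forall>i\<in>I. good i) \<and> finite {P\<in>\<Psi>. meets I P}"
    unfolding good_def meets_def
    by (rule bspec[OF bspec[OF lf[unfolded trop_locally_finite_def]] w]) (use \<tau> in blast)
  then obtain I where I: "finite I" "\<forall>i\<in>I. good i" "finite {P\<in>\<Psi>. meets I P}" by blast
  have meets_mono: "meets J Q" if "meets I' P" "P \<subseteq> Q" "J \<subseteq> I'" for J I' P Q
    using that unfolding meets_def by blast
  define \<F> where "\<F> = {P\<in>\<Psi>. meets I P \<and> rec_cone P = \<sigma>}"
  have fin\<F>: "finite \<F>" by (rule finite_subset[OF _ I(3)]) (auto simp: \<F>_def)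
  \<comment> \<open>Forms nonpositive on \<sigma> are bounded above on each of the finitely many
    cells with recession cone \<sigma>, hence uniformly.\<close>
  have bdd: "\<exists>c. \<forall>P\<in>\<F>. \<forall>x\<in>P. u \<bullet> x \<le> c" if u: "\<And>x. x \<in> \<sigma> \<Longrightarrow> u \<bullet> x \<le> 0" for u
  proof -
    have "\<exists>c. \<forall>x\<in>P. u \<bullet> x \<le> c" if P: "P \<in> \<F>" for P
    proof -
      have P': "P \<in> \<Psi>" "rec_cone P = \<sigma>" using P by (auto simp: \<F>_def)
      obtain c where "\<And>x. x \<in> P \<Longrightarrow> u \<bullet> x \<le> c"
        using polyhedron_bdd_above[OF complex_convex(1)[OF P'(1)], of u] u unfolding P'(2) by blast
      then show ?thesis by blast
    qed
    then obtain c where c: "\<And>P x. P \<in> \<F> \<Longrightarrow> x \<in> P \<Longrightarrow> u \<bullet> x \<le> c P" by metis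
    have "u \<bullet> x \<le> Max (c ` \<F>)" if "P \<in> \<F>" "x \<in> P" for P x
    proof -
      have "c P \<le> Max (c ` \<F>)" using fin\<F> that(1) by simp
      then show ?thesis using c[OF that] by linarith
    qed
    then show ?thesis by blast
  qed
  obtain i where i: "good i"
    and finL: "finite {Q. \<exists>F\<in>low. \<exists>s\<in>S. Q = minkowski F s \<and> meets (insert i I) Q}"
  proof (cases "\<tau> face_of \<sigma>")
    case True
    note c\<sigma> = fan_cone[OF \<Sigma> \<sigma>]
    obtain m where m: "\<And>x. x \<in> \<sigma> \<Longrightarrow> 0 \<le> m \<bullet> x" "\<tau> = {x\<in>\<sigma>. m \<bullet> x = 0}"
      using polyhedral_cone_face_exposed[OF c\<sigma>(1,3) True] fan_cone(2)[OF \<Sigma>, of \<tau>] \<tau> by blast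
    have "m \<bullet> v \<noteq> 0"
    proof
      assume "m \<bullet> v = 0"
      then have "\<sigma> \<subseteq> \<tau>"
        using subset_of_face_of[OF True, of \<sigma>] v(1) v_in m(2) by blast
      then show False using face_of_imp_subset[OF True] \<tau> by blast
    qed
    then have mv: "0 < m \<bullet> v" using m(1)[OF v_in] by simp
    obtain c where c: "\<And>P x. P \<in> \<F> \<Longrightarrow> x \<in> P \<Longrightarrow> (- m) \<bullet> x \<le> c"
      using bdd[of "- m"] m(1) by auto
    \<comment> \<open>For \<open>x = y + t v\<close> the neighbourhood gives
      \<open>m \<bullet> x < m \<bullet> w + 1\<close>, while \<open>m \<bullet> y \<ge> - c\<close>
      on the cells in \<open>\<F>\<close>; together they bound \<open>t\<close> by
      \<open>L\<close>.\<close>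
    define L where "L = (m \<bullet> w + 1 + c) / (m \<bullet> v)"
    define i where "i = (- m, - (m \<bullet> w) - 1)"
    have "{Q. \<exists>F\<in>low. \<exists>s\<in>S. Q = minkowski F s \<and> meets (insert i I) Q} \<subseteq>
      (\<lambda>(F, s). minkowski F s) `
        ((\<Union>P\<in>\<F>. {F. F face_of P}) \<times> {s\<in>S. \<exists>t. 0 \<le> t \<and> t \<le> L \<and> t *\<^sub>R v \<in> s})"
    proof (rule subsetI, elim CollectE bexE conjE)
      fix Q F s assume Fs: "F \<in> low" "s \<in> S" "Q = minkowski F s" "meets (insert i I) Q"
      obtain P where P: "P \<in> \<Psi>" "rec_cone P = \<sigma>" "F face_of P" "minkowski F s \<subseteq> P"
        using new_cell_subset[OF Fs(1,2)] .
      have "meets I P" by (rule meets_mono[OF Fs(4)]) (use P(4) Fs(3) in auto)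
      then have P\<F>: "P \<in> \<F>" using P by (simp add: \<F>_def)
      obtain x where x: "x \<in> Q" "- (m \<bullet> w) - 1 < (- m) \<bullet> x"
        using Fs(4) unfolding meets_def i_def by blast
      obtain y z where yz: "x = y + z" "y \<in> F" "z \<in> s"
        using x(1) unfolding Fs(3) by (rule mem_minkowskiE)
      obtain t where t: "0 \<le> t" "z = t *\<^sub>R v" using segment_coordinate[OF Fs(2) yz(3)] .
      have "- (m \<bullet> y) \<le> c" using c[OF P\<F>, of y] yz(2) face_of_imp_subset[OF P(3)] by auto
      then have "t * (m \<bullet> v) \<le> m \<bullet> w + 1 + c"
        using x(2) by (simp add: yz(1) t(2) inner_add_right)
      then have "t \<le> L" using mv by (simp add: L_def field_simps)
      then show "Q \<in> (\<lambda>(F, s). minkowski F s) `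
        ((\<Union>P\<in>\<F>. {F. F face_of P}) \<times> {s\<in>S. \<exists>t. 0 \<le> t \<and> t \<le> L \<and> t *\<^sub>R v \<in> s})"
        using Fs(2,3) P\<F> P(3) t yz(3) by (intro image_eqI[of _ _ "(F, s)"]) auto
    qed
    moreover have "finite {F. F face_of P}" if "P \<in> \<F>" for P
      using that by (intro finite_polyhedron_faces complex_convex) (simp add: \<F>_def)
    then have "finite ((\<Union>P\<in>\<F>. {F. F face_of P}) \<times> {s\<in>S. \<exists>t. 0 \<le> t \<and> t \<le> L \<and> t *\<^sub>R v \<in> s})"
      by (intro finite_cartesian_product finite_UN_I fin\<F> finite_segments_upto)
    ultimately have "finite {Q. \<exists>F\<in>low. \<exists>s\<in>S. Q = minkowski F s \<and> meets (insert i I) Q}"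
      by (rule finite_subset[OF _ finite_imageI])
    moreover have "good i" using m(2) by (auto simp: good_def i_def)
    ultimately show thesis using that by blast
  next
    case False
    obtain u where u: "\<And>x. x \<in> \<tau> \<Longrightarrow> 0 \<le> u \<bullet> x" "\<exists>x\<in>\<tau>. u \<bullet> x \<noteq> 0" "\<And>x. x \<in> \<sigma> \<Longrightarrow> u \<bullet> x \<le> 0"
      using separating_coordinate[OF _ False] \<tau> by blast
    obtain c where c: "\<And>P x. P \<in> \<F> \<Longrightarrow> x \<in> P \<Longrightarrow> u \<bullet> x \<le> c"
      using bdd[of u] u(3) by blast
    have "\<not> meets (insert (u, c) I) (minkowski F s)" if Fs: "F \<in> low" "s \<in> S" for F s
    proof
      assume meet: "meets (insert (u, c) I) (minkowski F s)"
      obtain P where P: "P \<in> \<Psi>" "rec_cone P = \<sigma>" "minkowski F s \<subseteq> P"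
        using new_cell_subset[OF Fs] .
      have "meets I P" by (rule meets_mono[OF meet P(3)]) auto
      then have "P \<in> \<F>" using P by (simp add: \<F>_def)
      moreover obtain x where "x \<in> minkowski F s" "c < u \<bullet> x"
        using meet unfolding meets_def by blast
      ultimately show False using c[of P x] P(3) by fastforce
    qed
    then have "{Q. \<exists>F\<in>low. \<exists>s\<in>S. Q = minkowski F s \<and> meets (insert (u, c) I) Q} = {}" by blast
    then have "finite {Q. \<exists>F\<in>low. \<exists>s\<in>S. Q = minkowski F s \<and> meets (insert (u, c) I) Q}"
      by (simp only: finite.emptyI)
    \<comment> \<open>Since \<open>u\<close> does not vanish on \<tau>, its value at the given point
      is infinity, so any real bound \<open>c\<close> is admissible.\<close>
    moreover have "good (u, c)" using u(1,2) unfolding good_def prod.case by blast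
    ultimately show thesis by (intro that)
  qed
  have "{P\<in>refined. meets (insert i I) P} \<subseteq> {P\<in>\<Psi>. meets I P} \<union>
      {Q. \<exists>F\<in>low. \<exists>s\<in>S. Q = minkowski F s \<and> meets (insert i I) Q}"
    using meets_mono[OF _ subset_refl, of "insert i I" _ I] unfolding refined_def by blast
  then have "finite {P\<in>refined. meets (insert i I) P}"
    by (rule finite_subset) (use I(3) finL in simp)
  then show "\<exists>I. finite I \<and>
     (\<forall>(u, c)\<in>I. (\<forall>x\<in>\<tau>. 0 \<le> u \<bullet> x) \<and> ((\<forall>x\<in>\<tau>. u \<bullet> x = 0) \<longrightarrow> c < u \<bullet> w)) \<and>
     finite {P\<in>refined. \<exists>y\<in>P. \<forall>(u, c)\<in>I. c < u \<bullet> y}"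
    using I(1,2) i unfolding meets_def good_def by (intro exI[of _ "insert i I"]) simp
qed

end

section \<open>Completions\<close>

text \<open>Each facet inequality must decrease strictly along \<open>v\<close>, for otherwise
  \<open>v\<close> would be a recession direction of that facet. This leaves room to prolong the
  segment from \<open>z\<close> to \<open>v\<close> beyond \<open>v\<close>.\<close>

lemma rec_cone_extends_beyond:
  fixes P :: "'a::euclidean_space set"
  assumes P: "polyhedron P" "P \<noteq> {}" and v: "v \<in> rec_cone P"
    and facets: "\<And>F. F facet_of P \<Longrightarrow> v \<notin> rec_cone F" and z: "z \<in> rec_cone P"
  obtains e where "0 < e" "v + e *\<^sub>R (v - z) \<in> rec_cone P"
proof -
  obtain H where H: "finite H" "P = (affine hull P) \<inter> \<Inter>H"
    "\<forall>h\<in>H. \<exists>a b. a \<noteq> 0 \<and> h = {x. a \<bullet> x \<le> b}"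
    "\<And>H'. H' \<subset> H \<Longrightarrow> P \<subset> (affine hull P) \<inter> \<Inter>H'"
    using P(1) unfolding polyhedron_Int_affine_minimal by blast
  obtain a b where ab: "\<And>h. h \<in> H \<Longrightarrow> a h \<noteq> 0 \<and> h = {x. a h \<bullet> x \<le> b h}"
    using H(3) by metis
  have neg: "a h \<bullet> v < 0" if h: "h \<in> H" for h
  proof -
    have bound: "a h \<bullet> x \<le> b h" if "x \<in> P" for x
      using that ab[OF h] h H(2) by blast
    define F where "F = P \<inter> {x. a h \<bullet> x = b h}"
    have "F facet_of P"
      using facet_of_polyhedron_explicit[OF H(1,2) ab H(4)] h unfolding F_def by blast
    then have "v \<notin> rec_cone F" by (rule facets)
    then obtain x t where xt: "x \<in> F" "0 \<le> t" "x + t *\<^sub>R v \<notin> F" unfolding rec_cone_def by blast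
    have x: "x \<in> P" "a h \<bullet> x = b h" using xt(1) by (auto simp: F_def)
    have "x + t *\<^sub>R v \<in> P" by (rule rec_coneD[OF v x(1) xt(2)])
    with xt(3) have "a h \<bullet> (x + t *\<^sub>R v) \<noteq> b h" "a h \<bullet> (x + t *\<^sub>R v) \<le> b h"
      using bound by (auto simp: F_def)
    moreover have "a h \<bullet> (x + t *\<^sub>R v) = b h + t * (a h \<bullet> v)" using x(2) by (simp add: inner_add_right)
    ultimately have "t * (a h \<bullet> v) < 0" by linarith
    then show ?thesis using xt(2) by (simp add: mult_less_0_iff)
  qed
  \<comment> \<open>The entry 1 covers an empty \<open>H\<close>, and the denominators
    \<open>1 + |a h \<bullet> z|\<close> are positive.\<close>
  define e where "e = Min (insert 1 ((\<lambda>h. - (a h \<bullet> v) / (1 + \<bar>a h \<bullet> z\<bar>)) ` H))"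
  have e0: "0 < e"
  proof -
    have "0 < - (a h \<bullet> v) / (1 + \<bar>a h \<bullet> z\<bar>)" if "h \<in> H" for h
      using neg[OF that] by (intro divide_pos_pos) auto
    then show ?thesis using H(1) unfolding e_def by (subst Min_gr_iff) auto
  qed
  have le: "a h \<bullet> (v + e *\<^sub>R (v - z)) \<le> 0" if h: "h \<in> H" for h
  proof -
    have "e \<le> - (a h \<bullet> v) / (1 + \<bar>a h \<bullet> z\<bar>)" unfolding e_def using H(1) h by simp
    moreover have "0 < 1 + \<bar>a h \<bullet> z\<bar>" by linarith
    ultimately have "e * (1 + \<bar>a h \<bullet> z\<bar>) \<le> - (a h \<bullet> v)" by (simp only: pos_le_divide_eq)
    moreover have "e * - (a h \<bullet> z) \<le> e * (1 + \<bar>a h \<bullet> z\<bar>)" using e0 by (intro mult_left_mono) auto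
    moreover have "e * (a h \<bullet> v) \<le> 0" using e0 neg[OF h] by (simp add: mult_nonneg_nonpos)
    moreover have "a h \<bullet> (v + e *\<^sub>R (v - z)) = a h \<bullet> v + e * (a h \<bullet> v) + e * - (a h \<bullet> z)"
      by (simp add: inner_add_right inner_diff_right algebra_simps)
    ultimately show ?thesis by linarith
  qed
  have "v + e *\<^sub>R (v - z) \<in> rec_cone P"
    unfolding rec_cone_def
  proof (intro CollectI ballI allI impI)
    fix x and t :: real assume x: "x \<in> P" and t: "0 \<le> t"
    have "x + 1 *\<^sub>R v \<in> P" "x + 1 *\<^sub>R z \<in> P" by (rule rec_coneD[OF v x] rec_coneD[OF z x]; simp)+
    \<comment> \<open>The coefficients sum to 1, so this affine combination stays in the hull; it is
      the desired point of the ray.\<close>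
    then have "(1 - t * (1 + e) + t * e) *\<^sub>R x + (t * (1 + e)) *\<^sub>R (x + v) + (- (t * e)) *\<^sub>R (x + z)
        \<in> affine hull P"
      using x by (intro mem_affine_3[OF affine_affine_hull]) (auto intro: hull_inc)
    also have "(1 - t * (1 + e) + t * e) *\<^sub>R x + (t * (1 + e)) *\<^sub>R (x + v) + (- (t * e)) *\<^sub>R (x + z)
        = x + t *\<^sub>R (v + e *\<^sub>R (v - z))" by (simp add: algebra_simps)
    finally have "x + t *\<^sub>R (v + e *\<^sub>R (v - z)) \<in> affine hull P" .
    moreover have "x + t *\<^sub>R (v + e *\<^sub>R (v - z)) \<in> h" if h: "h \<in> H" for h
    proof -
      have "a h \<bullet> x \<le> b h" using x ab[OF h] h H(2) by blast
      moreover have "t * (a h \<bullet> (v + e *\<^sub>R (v - z))) \<le> 0"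
        using t le[OF h] by (rule mult_nonneg_nonpos)
      ultimately have "a h \<bullet> (x + t *\<^sub>R (v + e *\<^sub>R (v - z))) \<le> b h"
        by (simp only: inner_add_right[of _ x] inner_scaleR_right[of _ t])
      then show ?thesis using ab[OF h] by blast
    qed
    ultimately show "x + t *\<^sub>R (v + e *\<^sub>R (v - z)) \<in> P" using H(2) by blast
  qed
  then show thesis using that e0 by blast
qed

text \<open>
  If \<open>P\<close> is minimal among the cells with \<open>v \<in> rec P\<close>, then \<open>v\<close> is no recession direction of a facet
  of \<open>P\<close>, so it is relatively interior to \<open>rec P\<close>.
\<close>

lemma fan_subset_rec_cones:
  fixes W :: "'a::euclidean_space set"
  assumes W: "subspace W" and \<Psi>: "finite \<Psi>" "polyhedral_complex \<Psi>" "\<Union>\<Psi> = W"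
    and \<Sigma>: "fan \<Sigma>" "rec_cone ` \<Psi> \<subseteq> \<Sigma>" and \<sigma>: "\<sigma> \<in> \<Sigma>" "\<sigma> \<subseteq> W"
  shows "\<sigma> \<in> rec_cone ` \<Psi>"
proof -
  note c\<sigma> = fan_cone[OF \<Sigma>(1) \<sigma>(1)]
  have convex: "closed P" "convex P" "P \<noteq> {}" "polyhedron P" if "P \<in> \<Psi>" for P
    using polyhedral_complexD(1,2)[OF \<Psi>(2) that] polyhedron_imp_closed polyhedron_imp_convex by auto
  obtain v where v: "v \<in> rel_interior \<sigma>"
    using rel_interior_eq_empty[of \<sigma>] c\<sigma>(1,2) polyhedron_imp_convex by blast
  have v\<sigma>: "v \<in> \<sigma>" using v rel_interior_subset by blast
  \<comment> \<open>Finitely many cells cover the points \<open>n v\<close> of \<open>W\<close>, so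
    one cell contains infinitely many of them and has \<open>v\<close> as a recession
    direction.\<close>
  have "\<exists>P\<in>\<Psi>. v \<in> rec_cone P"
  proof (rule ccontr)
    assume none: "\<not> (\<exists>P\<in>\<Psi>. v \<in> rec_cone P)"
    have "finite {n::nat. real n *\<^sub>R v \<in> P}" if P: "P \<in> \<Psi>" for P
    proof (rule ccontr)
      assume inf: "infinite {n::nat. real n *\<^sub>R v \<in> P}"
      have "v \<in> rec_cone P"
      proof (rule mem_rec_coneI_line[OF convex(1,2)[OF P], of 0])
        fix N :: real
        obtain n where "nat \<lceil>N\<rceil> < n" "real n *\<^sub>R v \<in> P"
          using inf unfolding infinite_nat_iff_unbounded by blast
        then show "\<exists>r\<ge>N. 0 + r *\<^sub>R v \<in> P" by (intro exI[of _ "real n"]) (simp; linarith)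
      qed
      then show False using none P by blast
    qed
    then have "finite (\<Union>P\<in>\<Psi>. {n::nat. real n *\<^sub>R v \<in> P})" using \<Psi>(1) by blast
    moreover have "real n *\<^sub>R v \<in> W" for n using W \<sigma>(2) v\<sigma> by (blast intro: subspace_scale)
    then have "(\<Union>P\<in>\<Psi>. {n::nat. real n *\<^sub>R v \<in> P}) = UNIV" using \<Psi>(3) by blast
    ultimately show False by simp
  qed
  then obtain P where P: "P \<in> \<Psi>" "v \<in> rec_cone P"
    and min: "\<And>Q. Q \<in> \<Psi> \<Longrightarrow> v \<in> rec_cone Q \<Longrightarrow> Q \<subseteq> P \<Longrightarrow> P = Q"
    using finite_has_minimal[of "{P\<in>\<Psi>. v \<in> rec_cone P}"] \<Psi>(1) by auto
  have facets: "v \<notin> rec_cone F" if F: "F facet_of P" for F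
  proof
    assume "v \<in> rec_cone F"
    moreover have "F \<in> \<Psi>"
      using F by (intro polyhedral_complexD(3)[OF \<Psi>(2) P(1)]) (auto simp: facet_of_def)
    ultimately have "P = F" using facet_of_imp_subset[OF F] min by blast
    then show False using F by (simp add: facet_of_irrefl)
  qed
  have R: "rec_cone P \<in> \<Sigma>" using \<Sigma>(2) P(1) by blast
  note f = fan_Int_face[OF \<Sigma>(1) \<sigma>(1) R]
  have "\<sigma> \<subseteq> \<sigma> \<inter> rec_cone P"
    by (rule subset_of_face_of[OF f(1)]) (use v P(2) v\<sigma> in auto)
  then have "\<sigma> \<inter> rec_cone P = \<sigma>" by blast
  then have face: "\<sigma> face_of rec_cone P" using f(2) by simp
  \<comment> \<open>As \<sigma> is a face of \<open>rec_cone P\<close>, it contains \<open>z\<close>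
    once \<open>v\<close> lies strictly inside a segment of that cone starting at
    \<open>z\<close>.\<close>
  have "z \<in> \<sigma>" if z: "z \<in> rec_cone P" for z
  proof (cases "z = v")
    case False
    obtain e where e: "0 < e" "v + e *\<^sub>R (v - z) \<in> rec_cone P"
      using rec_cone_extends_beyond[OF convex(4,3)[OF P(1)] P(2) facets z] .
    have "v = (1 - 1 / (1 + e)) *\<^sub>R z + (1 / (1 + e)) *\<^sub>R (v + e *\<^sub>R (v - z))"
    proof -
      have "(1 - k) *\<^sub>R z + k *\<^sub>R (v + e *\<^sub>R (v - z)) =
          (k * (1 + e)) *\<^sub>R v + (1 - k * (1 + e)) *\<^sub>R z" for k
        by (simp add: algebra_simps)
      from this[of "1 / (1 + e)"] show ?thesis using e(1) by simp
    qed
    moreover have "z \<noteq> v + e *\<^sub>R (v - z)"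
    proof
      assume "z = v + e *\<^sub>R (v - z)"
      then have "(1 + e) *\<^sub>R (v - z) = 0" by (simp add: algebra_simps)
      then show False using e(1) False by simp
    qed
    ultimately have "v \<in> open_segment z (v + e *\<^sub>R (v - z))"
      unfolding in_segment using e(1) by (intro conjI exI[of _ "1 / (1 + e)"]) auto
    then show ?thesis using face_ofD[OF face _ z e(2) v\<sigma>] by blast
  qed (use v\<sigma> in simp)
  then have "rec_cone P = \<sigma>" using face_of_imp_subset[OF face] by blast
  then show ?thesis using P(1) by blast
qed

section \<open>Removing the cones outside the target fan\<close>

lemma fan_remove_maximal:
  assumes \<Sigma>: "fan \<Sigma>" and \<sigma>: "\<sigma> \<in> \<Sigma>" "\<sigma> \<noteq> {0}"
    and maximal: "\<And>\<tau>. \<tau> \<in> \<Sigma> \<Longrightarrow> \<sigma> face_of \<tau> \<Longrightarrow> \<tau> = \<sigma>"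
  shows "fan (\<Sigma> - {\<sigma>})"
  unfolding fan_def polyhedral_complex_def
proof (intro conjI ballI allI impI; (elim conjE)?)
  have "{0} \<in> \<Sigma>" using fan_face[OF \<Sigma> \<sigma>(1) fan_zero[OF \<Sigma> \<sigma>(1)]] by simp
  then show "\<Sigma> - {\<sigma>} \<noteq> {}" using \<sigma>(2) by blast
  fix \<tau> assume \<tau>: "\<tau> \<in> \<Sigma> - {\<sigma>}"
  then show "polyhedron \<tau>" "\<tau> \<noteq> {}" using fan_cone[OF \<Sigma>] by blast+
  show "pointed_cone \<tau>" using \<tau> \<Sigma> by (simp add: fan_def)
  show "F \<in> \<Sigma> - {\<sigma>}" if "F face_of \<tau>" "F \<noteq> {}" for F
    using fan_face[OF \<Sigma>, of \<tau> F] maximal[of \<tau>] \<tau> that by blast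
  show "(\<tau> \<inter> \<tau>') face_of \<tau>" "(\<tau> \<inter> \<tau>') face_of \<tau>'" if "\<tau>' \<in> \<Sigma> - {\<sigma>}" for \<tau>'
    using fan_Int_face[OF \<Sigma>, of \<tau> \<tau>'] \<tau> that by auto
qed

text \<open>The generator of the ray is rescaled into the relative interior. It stays nonzero
  because a nonzero pointed cone does not have 0 in its relative interior.\<close>

lemma ray_through_rel_interior:
  fixes \<sigma> :: "'a::euclidean_space set"
  assumes \<Sigma>: "fan \<Sigma>" "\<sigma> \<in> \<Sigma>" "\<sigma> \<noteq> {0}" and \<rho>: "ray \<rho>" "\<rho> \<inter> rel_interior \<sigma> \<noteq> {}"
  obtains v where "v \<in> rel_interior \<sigma>" "v \<noteq> 0" "\<rho> = {t *\<^sub>R v |t. t \<ge> 0}"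
proof -
  note c\<sigma> = fan_cone[OF \<Sigma>(1,2)]
  have zero: "0 \<notin> rel_interior \<sigma>"
  proof
    assume 0: "0 \<in> rel_interior \<sigma>"
    have "x = 0" if x: "x \<in> \<sigma>" for x
    proof -
      \<comment> \<open>Prolonging from \<open>x\<close> beyond 0 and rescaling by
        \<open>1 / (e - 1)\<close> yields \<open>- x\<close>.\<close>
      obtain e where e: "1 < e" "(1 - e) *\<^sub>R x + e *\<^sub>R 0 \<in> \<sigma>"
        using convex_rel_interior_iff[OF polyhedron_imp_convex[OF c\<sigma>(1)] c\<sigma>(2), of 0] 0 x by blast
      then have "(1 / (e - 1)) *\<^sub>R ((1 - e) *\<^sub>R x + e *\<^sub>R 0) \<in> \<sigma>"
        using c\<sigma>(3) e(1) unfolding cone_def by (meson divide_nonneg_pos diff_gt_0_iff_gt zero_le_one)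
      moreover have "(1 / (e - 1)) *\<^sub>R ((1 - e) *\<^sub>R x + e *\<^sub>R 0) = ((1 - e) / (e - 1)) *\<^sub>R x" by simp
      moreover have "(1 - e) / (e - 1) = -1" using e(1) by (simp add: field_simps)
      ultimately have "- x \<in> \<sigma>" by simp
      then show ?thesis using c\<sigma>(5) x by blast
    qed
    then show False using \<Sigma>(3) c\<sigma>(4) by blast
  qed
  obtain w where w: "w \<noteq> 0" "\<rho> = {t *\<^sub>R w |t. t \<ge> 0}" using \<rho>(1) unfolding ray_def by blast
  obtain k where k: "0 \<le> k" "k *\<^sub>R w \<in> rel_interior \<sigma>" using \<rho>(2) unfolding w(2) by blast
  have "k \<noteq> 0" using zero k(2) by auto
  then have k0: "0 < k" using k(1) by simp
  show thesis
  proof (rule that[OF k(2)])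
    show "k *\<^sub>R w \<noteq> 0" using k0 w(1) by simp
    show "\<rho> = {t *\<^sub>R (k *\<^sub>R w) |t. t \<ge> 0}"
      unfolding w(2)
    proof (intro subset_antisym subsetI)
      fix x assume "x \<in> {t *\<^sub>R w |t. t \<ge> 0}"
      then obtain t where "0 \<le> t" "x = t *\<^sub>R w" by blast
      then show "x \<in> {t *\<^sub>R (k *\<^sub>R w) |t. t \<ge> 0}"
        using k0 by (intro CollectI exI[of _ "t / k"]) simp
    next
      fix x assume "x \<in> {t *\<^sub>R (k *\<^sub>R w) |t. t \<ge> 0}"
      then obtain t where "0 \<le> t" "x = t *\<^sub>R (k *\<^sub>R w)" by blast
      then show "x \<in> {t *\<^sub>R w |t. t \<ge> 0}"
        using k0 by (intro CollectI exI[of _ "t * k"]) simp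
    qed
  qed
qed

lemma daggerD:
  assumes "dagger \<P>"
  shows "\<And>P Q. P \<in> \<P> \<Longrightarrow> Q \<in> \<P> \<Longrightarrow> minkowski P Q \<in> \<P>"
    and "\<And>\<sigma>. \<sigma> \<in> rec_cone ` \<P> \<Longrightarrow> \<sigma> \<noteq> {0} \<Longrightarrow>
      \<exists>\<rho>\<in>rec_cone ` \<P>. ray \<rho> \<and> \<rho> \<inter> rel_interior \<sigma> \<noteq> {}"
    and "\<And>\<rho>. \<rho> \<in> rec_cone ` \<P> \<Longrightarrow> ray \<rho> \<Longrightarrow>
      \<exists>S. complex_in \<P> S \<and> (\<forall>P\<in>S. polytope P) \<and> \<Union>S = \<rho> \<and>
        locally_finite_in (top_of_set \<rho>) S"
proof -
  note d = assms[unfolded dagger_def, folded minkowski_def]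
  note d1 = conjunct1[OF d] and d2 = conjunct1[OF conjunct2[OF d]] and d3 = conjunct2[OF conjunct2[OF d]]
  show "minkowski P Q \<in> \<P>" if "P \<in> \<P>" "Q \<in> \<P>" for P Q
    by (rule bspec[OF bspec[OF d1 that(1)] that(2)])
  show "\<exists>\<rho>\<in>rec_cone ` \<P>. ray \<rho> \<and> \<rho> \<inter> rel_interior \<sigma> \<noteq> {}"
    if "\<sigma> \<in> rec_cone ` \<P>" "\<sigma> \<noteq> {0}" for \<sigma>
    by (rule mp[OF bspec[OF d2 that(1)] that(2)])
  show "\<exists>S. complex_in \<P> S \<and> (\<forall>P\<in>S. polytope P) \<and> \<Union>S = \<rho> \<and>
      locally_finite_in (top_of_set \<rho>) S"
    if "\<rho> \<in> rec_cone ` \<P>" "ray \<rho>" for \<rho>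
    by (rule mp[OF bspec[OF d3 that(1)] that(2)])
qed

text \<open>The invariant of the removal process, with target fan \<open>\<Sigma>0\<close> and
  current fan \<open>\<Sigma>\<close>. The two inclusions keep the recession cones between these
  fans, so they give equality once the fans agree.\<close>

definition completion_within ::
  "'a::euclidean_space set \<Rightarrow> 'a set set \<Rightarrow> 'a set set \<Rightarrow> 'a set set \<Rightarrow> 'a set set \<Rightarrow> 'a set set \<Rightarrow> bool"
  where "completion_within W \<P> \<Phi> \<Sigma>0 \<Sigma> \<Psi> \<longleftrightarrow>
    complex_in \<P> \<Psi> \<and> \<Phi> \<subseteq> \<Psi> \<and> \<Union>\<Psi> = W \<and> rec_cone ` \<Psi> \<subseteq> \<Sigma> \<and> \<Sigma>0 \<subseteq> rec_cone ` \<Psi> \<and>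
    trop_locally_finite W \<Sigma> \<Psi>"

text \<open>The conditions in \<open>dagger\<close> provide the ray through \<sigma>, its
  subdivision, and membership of the sums in the class. Cells of \<open>\<Phi>\<close> survive
  because their recession cones lie in \<open>\<Sigma>0\<close>, which does not contain
  \<sigma>.\<close>

lemma completion_remove_cone:
  fixes W :: "'a::euclidean_space set"
  assumes \<P>: "\<forall>P\<in>\<P>. polyhedron P" "dagger \<P>"
    and \<Phi>: "rec_cone ` \<Phi> \<subseteq> \<Sigma>0"
    and \<Psi>: "completion_within W \<P> \<Phi> \<Sigma>0 \<Sigma> \<Psi>"
    and \<Sigma>: "fan \<Sigma>" and remove: "\<sigma> \<in> \<Sigma>" "\<sigma> \<notin> \<Sigma>0" "\<sigma> \<noteq> {0}"
    and maximal: "\<And>\<tau>. \<tau> \<in> \<Sigma> \<Longrightarrow> \<sigma> face_of \<tau> \<Longrightarrow> \<tau> = \<sigma>"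
  shows "\<exists>\<Psi>'. completion_within W \<P> \<Phi> \<Sigma>0 (\<Sigma> - {\<sigma>}) \<Psi>'"
proof (cases "\<sigma> \<in> rec_cone ` \<Psi>")
  case False
  \<comment> \<open>Local finiteness is tested at the strata of the fan, so it persists when the fan
    shrinks.\<close>
  then have "completion_within W \<P> \<Phi> \<Sigma>0 (\<Sigma> - {\<sigma>}) \<Psi>"
    using \<Psi> unfolding completion_within_def trop_locally_finite_def by blast
  then show ?thesis by blast
next
  case True
  have \<Psi>': "polyhedral_complex \<Psi>" "\<Psi> \<subseteq> \<P>" "\<Phi> \<subseteq> \<Psi>" "\<Union>\<Psi> = W" "rec_cone ` \<Psi> \<subseteq> \<Sigma>"
    "\<Sigma>0 \<subseteq> rec_cone ` \<Psi>" "trop_locally_finite W \<Sigma> \<Psi>"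
    using \<Psi> by (auto simp: completion_within_def complex_in_def)
  have "\<sigma> \<in> rec_cone ` \<P>" using True \<Psi>'(2) by blast
  then obtain \<rho> where \<rho>: "\<rho> \<in> rec_cone ` \<P>" "ray \<rho>" "\<rho> \<inter> rel_interior \<sigma> \<noteq> {}"
    using daggerD(2)[OF \<P>(2) _ remove(3)] by blast
  obtain S where sub: "complex_in \<P> S" "\<forall>P\<in>S. polytope P" "\<Union>S = \<rho>"
    "locally_finite_in (top_of_set \<rho>) S"
    using daggerD(3)[OF \<P>(2) \<rho>(1,2)] by blast
  obtain v where dir: "v \<in> rel_interior \<sigma>" "v \<noteq> 0" "\<rho> = {t *\<^sub>R v |t. t \<ge> 0}"
    using ray_through_rel_interior[OF \<Sigma> remove(1,3) \<rho>(2,3)] .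
  interpret ray_refinement \<Psi> \<Sigma> S \<sigma> v
  proof
    show "polyhedral_complex S" using sub(1) unfolding complex_in_def by blast
    show "polytope s" if "s \<in> S" for s using sub(2) that by blast
    show "\<Union>S = {t *\<^sub>R v |t. t \<ge> 0}" using sub(3) dir(3) by simp
    show "locally_finite_in (top_of_set {t *\<^sub>R v |t. t \<ge> 0}) S" using sub(4) unfolding dir(3) .
    show "\<tau> = \<sigma>" if "\<tau> \<in> \<Sigma>" "\<sigma> face_of \<tau>" for \<tau> using that by (rule maximal)
    show "polyhedral_complex \<Psi>" "rec_cone ` \<Psi> \<subseteq> \<Sigma>" by (fact \<Psi>')+
    show "fan \<Sigma>" by (fact \<Sigma>)
    show "\<sigma> \<in> \<Sigma>" by (fact remove)
    show "v \<in> rel_interior \<sigma>" "v \<noteq> 0" by (fact dir)+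
  qed
  have new: "minkowski F s \<in> \<P>" if "F \<in> low" "s \<in> S" for F s
  proof -
    have "F \<in> \<P>" "s \<in> \<P>" using that \<Psi>'(2) sub(1) unfolding low_def complex_in_def by blast+
    then show ?thesis by (rule daggerD(1)[OF \<P>(2)])
  qed
  have "completion_within W \<P> \<Phi> \<Sigma>0 (\<Sigma> - {\<sigma>}) refined"
    unfolding completion_within_def complex_in_def
  proof (intro conjI)
    show "polyhedral_complex refined"
      by (rule polyhedral_complex_refined) (use new \<P>(1) in blast)
    show "refined \<subseteq> \<P>" using new \<Psi>'(2) unfolding refined_def by blast
    show "\<Phi> \<subseteq> refined" using \<Psi>'(3) \<Phi> remove(2) unfolding refined_def by blast
    show "\<Union>refined = W" using Union_refined \<Psi>'(4) by simp
    show "rec_cone ` refined \<subseteq> \<Sigma> - {\<sigma>}" by (rule rec_cone_refined)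
    show "\<Sigma>0 \<subseteq> rec_cone ` refined"
    proof
      fix \<tau> assume "\<tau> \<in> \<Sigma>0"
      then obtain P where "P \<in> \<Psi>" "\<tau> = rec_cone P" "\<tau> \<noteq> \<sigma>" using \<Psi>'(6) remove(2) by blast
      then show "\<tau> \<in> rec_cone ` refined" unfolding refined_def by blast
    qed
    show "trop_locally_finite W (\<Sigma> - {\<sigma>}) refined" by (rule trop_locally_finite_refined[OF \<Psi>'(7)])
  qed
  then show ?thesis by blast
qed

lemma completion_shrink_fan:
  fixes W :: "'a::euclidean_space set"
  assumes \<P>: "\<forall>P\<in>\<P>. polyhedron P" "dagger \<P>"
    and \<Phi>: "rec_cone ` \<Phi> \<subseteq> \<Sigma>0" and \<Sigma>0: "fan \<Sigma>0"
    and "finite \<Sigma>" "fan \<Sigma>" "\<Sigma>0 \<subseteq> \<Sigma>" "completion_within W \<P> \<Phi> \<Sigma>0 \<Sigma> \<Psi>"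
  shows "\<exists>\<Psi>'. completion_within W \<P> \<Phi> \<Sigma>0 \<Sigma>0 \<Psi>'"
  using assms(5-8)
proof (induction "card \<Sigma>" arbitrary: \<Sigma> \<Psi> rule: less_induct)
  case less
  show ?case
  proof (cases "\<Sigma> = \<Sigma>0")
    case True then show ?thesis using less.prems by blast
  next
    case False
    then have "finite (\<Sigma> - \<Sigma>0)" "\<Sigma> - \<Sigma>0 \<noteq> {}" using less.prems(1,3) by auto
    \<comment> \<open>A cone maximal outside \<open>\<Sigma>0\<close> is maximal in the whole fan,
      because \<open>\<Sigma>0\<close> contains the nonempty faces of its members.\<close>
    then have "\<exists>\<sigma>\<in>\<Sigma> - \<Sigma>0. \<forall>\<tau>\<in>\<Sigma> - \<Sigma>0. \<sigma> \<subseteq> \<tau> \<longrightarrow> \<sigma> = \<tau>" by (rule finite_has_maximal)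
    then obtain \<sigma> where \<sigma>: "\<sigma> \<in> \<Sigma>" "\<sigma> \<notin> \<Sigma>0"
      and max: "\<And>\<tau>. \<tau> \<in> \<Sigma> \<Longrightarrow> \<tau> \<notin> \<Sigma>0 \<Longrightarrow> \<sigma> \<subseteq> \<tau> \<Longrightarrow> \<sigma> = \<tau>"
      by (elim bexE DiffE) simp
    have "\<sigma> \<noteq> {}" using fan_cone(2)[OF less.prems(2) \<sigma>(1)] .
    then have maximal: "\<tau> = \<sigma>" if "\<tau> \<in> \<Sigma>" "\<sigma> face_of \<tau>" for \<tau>
    proof -
      have "\<tau> \<notin> \<Sigma>0" using fan_face[OF \<Sigma>0 _ that(2) \<open>\<sigma> \<noteq> {}\<close>] \<sigma>(2) by blast
      then show ?thesis using max[OF that(1) _ face_of_imp_subset[OF that(2)]] by simp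
    qed
    obtain \<tau> where "\<tau> \<in> \<Sigma>0" using \<Sigma>0 by (auto simp: fan_def)
    then have "{0} \<in> \<Sigma>0" using fan_face[OF \<Sigma>0 _ fan_zero[OF \<Sigma>0]] by simp
    then have "\<sigma> \<noteq> {0}" using \<sigma>(2) by blast
    obtain \<Psi>' where \<Psi>': "completion_within W \<P> \<Phi> \<Sigma>0 (\<Sigma> - {\<sigma>}) \<Psi>'"
      using completion_remove_cone[OF \<P> \<Phi> less.prems(4,2) \<sigma> \<open>\<sigma> \<noteq> {0}\<close> maximal] by blast
    show ?thesis
    proof (rule less.hyps[OF _ _ _ _ \<Psi>'])
      show "card (\<Sigma> - {\<sigma>}) < card \<Sigma>" using less.prems(1) \<sigma>(1) by (intro psubset_card_mono) auto
      show "fan (\<Sigma> - {\<sigma>})" by (rule fan_remove_maximal[OF less.prems(2) \<sigma>(1) \<open>\<sigma> \<noteq> {0}\<close> maximal])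
    qed (use less.prems(1,3) \<sigma>(2) in auto)
  qed
qed

lemma rec_cone_subset_subspace:
  assumes "subspace W" "P \<subseteq> W" "P \<noteq> {}"
  shows "rec_cone P \<subseteq> W"
proof
  fix v assume v: "v \<in> rec_cone P"
  obtain x where x: "x \<in> P" using assms(3) by blast
  have "x + 1 *\<^sub>R v \<in> W" using rec_coneD[OF v x, of 1] assms(2) by auto
  then have "(x + 1 *\<^sub>R v) - x \<in> W" using assms(1,2) x by (blast intro: subspace_diff)
  then show "v \<in> W" by simp
qed

theorem theorem4p5:
  fixes W :: "'a::euclidean_space set" and \<P> \<Sigma> \<Phi> :: "'a set set"
  assumes "subspace W"
    and "\<forall>P\<in>\<P>. polyhedron P \<and> P \<noteq> {} \<and> P \<subseteq> W"
    and "dagger \<P>"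
    and "finite_rec_restricted_completions W \<P>"
    and "finite \<Sigma>" and "fan_in (rec_cone ` \<P>) \<Sigma>"
    and "finite \<Phi>" and "complex_in \<P> \<Phi>"
    and "\<forall>P\<in>\<Phi>. rec_cone P \<in> \<Sigma>"
  shows "\<exists>\<Psi>. completion_in W \<P> \<Phi> \<Psi> \<and>
              locally_finite_in (trop_toric W \<Sigma>) ((`) trop_incl ` \<Psi>) \<and>
              {rec_cone P |P. P \<in> \<Psi>} = \<Sigma>"
proof -
  have \<Sigma>: "fan \<Sigma>" "\<Sigma> \<subseteq> rec_cone ` \<P>" using assms(6) by (auto simp: fan_in_def)
  have \<Sigma>W: "\<sigma> \<subseteq> W" if \<sigma>: "\<sigma> \<in> \<Sigma>" for \<sigma>
  proof -
    obtain P where "P \<in> \<P>" "\<sigma> = rec_cone P" using \<Sigma>(2) \<sigma> by blast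
    then show ?thesis using rec_cone_subset_subspace[OF assms(1), of P] assms(2) by simp
  qed
  have \<Phi>: "rec_cone ` \<Phi> \<subseteq> \<Sigma>" using assms(9) by blast
  obtain \<Omega> where \<Omega>: "finite \<Omega>" "completion_in W \<P> \<Phi> \<Omega>" "fan (rec_cone ` \<Omega> \<union> \<Sigma>)"
    using mp[OF spec[OF spec[OF assms(4)[unfolded finite_rec_restricted_completions_def], of \<Sigma>], of \<Phi>],
      OF conjI[OF assms(5) conjI[OF assms(6) conjI[OF assms(7) conjI[OF assms(8) \<Phi>]]]]]
    by (elim exE conjE)
  have \<Omega>': "complex_in \<P> \<Omega>" "polyhedral_complex \<Omega>" "\<Phi> \<subseteq> \<Omega>" "\<Union>\<Omega> = W"
    using \<Omega>(2) by (auto simp: completion_in_def complex_in_def)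
  \<comment> \<open>The union in the completion hypothesis does not yet say that each cone of
    \<open>\<Sigma>\<close> occurs as a recession cone; this follows because the cells cover
    \<open>W\<close>.\<close>
  have "\<Sigma> \<subseteq> rec_cone ` \<Omega>"
    using fan_subset_rec_cones[OF assms(1) \<Omega>(1) \<Omega>'(2,4) \<Omega>(3)] \<Sigma>W by blast
  \<comment> \<open>A finite complex needs no coordinate conditions at all.\<close>
  moreover have "trop_locally_finite W (rec_cone ` \<Omega> \<union> \<Sigma>) \<Omega>"
    unfolding trop_locally_finite_def using \<Omega>(1) by (intro ballI exI[of _ "{}"]) simp
  ultimately have "completion_within W \<P> \<Phi> \<Sigma> (rec_cone ` \<Omega> \<union> \<Sigma>) \<Omega>"
    using \<Omega>' unfolding completion_within_def by blast
  then obtain \<Psi> where \<Psi>: "completion_within W \<P> \<Phi> \<Sigma> \<Sigma> \<Psi>"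
    using completion_shrink_fan[OF _ assms(3) \<Phi> \<Sigma>(1) _ \<Omega>(3)] assms(2,5) \<Omega>(1) by fastforce
  have "completion_in W \<P> \<Phi> \<Psi>"
    using \<Psi> assms(8) unfolding completion_in_def completion_within_def complex_in_def by blast
  moreover have "locally_finite_in (trop_toric W \<Sigma>) ((`) trop_incl ` \<Psi>)"
    using \<Psi> unfolding completion_within_def
    by (intro locally_finite_in_trop_toric[OF assms(1) \<Sigma>(1) \<Sigma>W]) auto
  moreover have "{rec_cone P |P. P \<in> \<Psi>} = \<Sigma>"
    using \<Psi> unfolding completion_within_def by blast
  ultimately show ?thesis by blast
qed

end
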